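(* Fix a positive integer $k$, and for $q\in\mathbb N$ let $G_q=C_q^k$ be the Cartesian product of $k$ copies of the cycle $C_q$ with $q$ vertices. Then the chromatic polynomial $\chi_{G_q}(n)$ is a two-level polynomial of degree function $q^k$ and depth function $e(q)=q-2$ (where, for $q=0$, the value is read as $-1$).
   Context: $\mathbb N=\{0,1,2,\dots\}$. For the degenerate cases take $C_0$ the graph with no vertices, $C_1$ a single vertex without edges, and $C_2$ two vertices joined by an edge. The Cartesian product $G\times H$ has vertices $(u,v)$ with $u\in V(G)$, $v\in V(H)$, and edges $(u,v)\sim(u,v')$ for $v\sim v'$ in $H$, and $(u,v)\sim(u',v)$ for $u\sim u'$ in $G$. The chromatic polynomial $\chi_G(n)$ counts colorings of the vertices of $G$ with $n$ colors such that adjacent vertices get different colors (it is $1$ for the graph with no vertices). A numerical polynomial is $g\in\mathbb Q[x]$ with $g(q)\in\mathbb Z$ for all $q\in\mathbb Z$. Two-level polynomial: let $g$ be an eventually nonnegative numerical polynomial, $S=\{q\in\mathbb N: g(q)\ge0\}$, $e:S\to\mathbb N\cup\{-1,\infty\}$. A two-level polynomial of degree function $g$ and depth function $e$ is a sequence of polynomials $\{f_q\}_{q\in S}$, $f_q(n)$ of degree $g(q)$, such that, writing $f_q(n)=\sum_{r\ge0}c_r(q)n^{g(q)-r}$ with $c_r(q)=0$ for $r>g(q)$, there exist polynomials $\{\phi_r(q)\}_{r\ge0}$ with $c_r(q)=\phi_r(q)$ for every $q\in S$ and every $r\le e(q)$ (vacuous if $e(q)=-1$). (The depth function is not claimed to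 be optimal.) *)

theory Defs
  imports
    "HOL-Computational_Algebra.Polynomial"
    "HOL-Library.FuncSet"
    "HOL-Library.Extended_Real"
    "Graph_Theory.Pair_Digraph"
begin

section \<open>Cycles, Cartesian products and Cartesian powers\<close>

text \<open>
  A finite simple graph is a \<^typ>\<open>'a pair_pre_digraph\<close> satisfying \<^locale>\<open>pair_graph\<close>:
  an undirected edge is the pair of its two opposite arcs.
\<close>

text \<open>
  The condition \<open>i \<noteq> j\<close> only removes the loop for \<open>q = 1\<close>.  For \<open>q = 2\<close> the two
  clauses give the same single edge, and for \<open>q = 0\<close> there are no vertices.
\<close>

definition cycle_graph :: "nat \<Rightarrow> nat pair_pre_digraph" where
  "cycle_graph q =
     \<lparr> pverts = {..<q},
       parcs = {(i, j). i < q \<and> j < q \<and> i \<noteq> j \<and>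
                        (j = Suc i mod q \<or> i = Suc j mod q)} \<rparr>"

definition cartesian_product ::
    "'a pair_pre_digraph \<Rightarrow> 'b pair_pre_digraph \<Rightarrow> ('a \<times> 'b) pair_pre_digraph" where
  "cartesian_product G H =
     \<lparr> pverts = pverts G \<times> pverts H,
       parcs = {((u, v), (u, v')) | u v v'. u \<in> pverts G \<and> (v, v') \<in> parcs H} \<union>
               {((u, v), (u', v)) | u u' v. (u, u') \<in> parcs G \<and> v \<in> pverts H} \<rparr>"

definition relabel_graph :: "('a \<Rightarrow> 'b) \<Rightarrow> 'a pair_pre_digraph \<Rightarrow> 'b pair_pre_digraph" where
  "relabel_graph h G = \<lparr> pverts = h ` pverts G, parcs = map_prod h h ` parcs G \<rparr>"

text \<open>
  The vertex type of an iterated product would depend on the number of factors.  Each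
  vertex \<open>(u, vs)\<close> of \<open>G \<times> G\<^sup>k\<close> is therefore renamed to the list \<open>u # vs\<close>, so that the
  vertices of \<open>G\<^sup>k\<close> are lists of length \<open>k\<close>.
\<close>

primrec cartesian_power :: "'a pair_pre_digraph \<Rightarrow> nat \<Rightarrow> 'a list pair_pre_digraph" where
  "cartesian_power G 0 = \<lparr> pverts = {[]}, parcs = {} \<rparr>"
| "cartesian_power G (Suc k) =
     relabel_graph (\<lambda>(u, vs). u # vs) (cartesian_product G (cartesian_power G k))"

lemma pair_graph_iff:
  "pair_graph G \<longleftrightarrow> finite (pverts G) \<and>
     (\<forall>u v. (u, v) \<in> parcs G \<longrightarrow>
        u \<in> pverts G \<and> v \<in> pverts G \<and> u \<noteq> v \<and> (v, u) \<in> parcs G)"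
  (is "?L \<longleftrightarrow> ?R")
proof
  assume ?L
  then interpret pair_graph G .
  show ?R
    using pair_finite_verts by (auto dest: in_arcsD1 in_arcsD2 no_loops' arcs_symmetric)
next
  assume R: ?R
  have "finite (parcs G)"
    by (rule finite_subset[of _ "pverts G \<times> pverts G"]) (use R in auto)
  with R show ?L
    by unfold_locales (auto simp: symmetric_def intro!: symI)
qed

lemma pair_graph_cycle_graph: "pair_graph (cycle_graph q)"
  by (auto simp: pair_graph_iff cycle_graph_def)

lemma pair_graph_cartesian_product:
  "pair_graph G \<Longrightarrow> pair_graph H \<Longrightarrow> pair_graph (cartesian_product G H)"
  unfolding pair_graph_iff cartesian_product_def by auto

lemma pair_graph_relabel_graph:
  "pair_graph G \<Longrightarrow> inj_on h (pverts G) \<Longrightarrow> pair_graph (relabel_graph h G)"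
  unfolding pair_graph_iff relabel_graph_def
  by (auto simp: map_prod_def image_iff dest: inj_onD) (force dest: inj_onD)+

lemma pair_graph_cartesian_power: "pair_graph G \<Longrightarrow> pair_graph (cartesian_power G k)"
proof (induction k)
  case 0
  show ?case by (simp add: pair_graph_iff)
next
  case (Suc k)
  then show ?case
    by (auto intro!: pair_graph_relabel_graph pair_graph_cartesian_product inj_onI)
qed

section \<open>The chromatic polynomial\<close>

definition proper_colorings :: "'a pair_pre_digraph \<Rightarrow> nat \<Rightarrow> ('a \<Rightarrow> nat) set" where
  "proper_colorings G n =
     {c \<in> pverts G \<rightarrow>\<^sub>E {..<n}. \<forall>(u, v) \<in> parcs G. c u \<noteq> c v}"

definition chromatic_poly :: "'a pair_pre_digraph \<Rightarrow> rat poly" where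
  "chromatic_poly G =
     (THE p. \<forall>n. poly p (of_nat n) = of_nat (card (proper_colorings G n)))"

text \<open>The polynomial in this definition exists and is unique for finite graphs.\<close>

lemma rat_poly_eqI_of_nat:
  fixes p q :: "rat poly"
  assumes "\<And>n. poly p (of_nat n) = poly q (of_nat n)"
  shows "p = q"
proof (rule ccontr)
  assume "p \<noteq> q"
  then have "finite {x. poly (p - q) x = 0}"
    by (intro poly_roots_finite) simp
  moreover have "range of_nat \<subseteq> {x. poly (p - q) x = 0}"
    using assms by auto
  ultimately have "finite (range (of_nat :: nat \<Rightarrow> rat))"
    by (rule finite_subset[rotated])
  then show False
    using finite_imageD[of "of_nat :: nat \<Rightarrow> rat" UNIV] by (simp add: inj_of_nat)
qed

lemma chromatic_poly_exists:
  assumes fin: "finite (pverts G)" and wf: "parcs G \<subseteq> pverts G \<times> pverts G"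
  shows "\<exists>p :: rat poly. \<forall>n. poly p (of_nat n) = of_nat (card (proper_colorings G n))"
proof -
  define V where "V = pverts G"
  define onto where
    "onto S = {c \<in> V \<rightarrow>\<^sub>E S. c ` V = S \<and> (\<forall>(u, v) \<in> parcs G. c u \<noteq> c v)}" for S :: "nat set"
  define s where "s i = card (onto {..<i})" for i
  have finV: "finite V"
    using fin by (simp add: V_def)
  have fin_onto: "finite (onto S)" if "finite S" for S
    by (rule finite_subset[of _ "V \<rightarrow>\<^sub>E S"]) (use finV that in \<open>auto simp: onto_def intro: finite_PiE\<close>)
  have card_le: "card (onto S) \<le> card (onto T)" if ST: "finite S" "finite T" "card S = card T" for S T
  proof -
    obtain h where h: "bij_betw h S T"
      using finite_same_card_bij[OF ST] by blast
    have inj: "inj_on (\<lambda>c. \<lambda>x\<in>V. h (c x)) (onto S)"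
    proof (rule inj_onI)
      fix c d assume cd: "c \<in> onto S" "d \<in> onto S"
        and eq: "(\<lambda>x\<in>V. h (c x)) = (\<lambda>x\<in>V. h (d x))"
      show "c = d"
      proof (rule PiE_ext)
        show "c \<in> V \<rightarrow>\<^sub>E S" "d \<in> V \<rightarrow>\<^sub>E S"
          using cd by (auto simp: onto_def)
        fix x assume x: "x \<in> V"
        have "h (c x) = h (d x)"
          using fun_cong[OF eq, of x] x by simp
        moreover have "c x \<in> S" "d x \<in> S"
          using cd x by (auto simp: onto_def)
        ultimately show "c x = d x"
          using h by (auto simp: bij_betw_def dest: inj_onD)
      qed
    qed
    have "(\<lambda>c. \<lambda>x\<in>V. h (c x)) ` onto S \<subseteq> onto T"
    proof (rule image_subsetI)
      fix c assume c: "c \<in> onto S"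
      then have cV: "c ` V = S" by (auto simp: onto_def)
      have "(\<lambda>x\<in>V. h (c x)) ` V = h ` c ` V"
        by (auto simp: image_image)
      then have img: "(\<lambda>x\<in>V. h (c x)) ` V = T"
        using cV h by (simp add: bij_betw_def)
      have proper: "(\<lambda>x\<in>V. h (c x)) u \<noteq> (\<lambda>x\<in>V. h (c x)) v" if uv: "(u, v) \<in> parcs G" for u v
      proof -
        have V: "u \<in> V" "v \<in> V" using uv wf by (auto simp: V_def)
        moreover have "c u \<noteq> c v" using c uv by (auto simp: onto_def)
        moreover have "c u \<in> S" "c v \<in> S" using V cV by auto
        ultimately show ?thesis using h by (auto simp: bij_betw_def dest: inj_onD)
      qed
      have "(\<lambda>x\<in>V. h (c x)) \<in> V \<rightarrow>\<^sub>E T" using img by auto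
      with img proper show "(\<lambda>x\<in>V. h (c x)) \<in> onto T"
        unfolding onto_def by blast
    qed
    with inj show ?thesis by (intro card_inj_on_le fin_onto ST(2))
  qed
  have card_onto: "card (onto S) = s (card S)" if "finite S" for S
    unfolding s_def using that by (intro antisym card_le) auto
  have count: "card (proper_colorings G n) = (\<Sum>i\<le>card V. (n choose i) * s i)" for n
  proof -
    let ?P = "{S. S \<subseteq> {..<n} \<and> card S \<le> card V}"
    have finP: "finite ?P" by simp
    have "proper_colorings G n = (\<Union>S\<in>?P. onto S)"
    proof (intro equalityI subsetI)
      fix c assume c: "c \<in> proper_colorings G n"
      then have "c ` V \<in> ?P" "c \<in> onto (c ` V)"
        using card_image_le[OF finV, of c]
        by (auto simp: proper_colorings_def onto_def V_def[symmetric] PiE_def)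
      then show "c \<in> (\<Union>S\<in>?P. onto S)" by blast
    next
      fix c assume "c \<in> (\<Union>S\<in>?P. onto S)"
      then show "c \<in> proper_colorings G n"
        by (auto simp: proper_colorings_def onto_def V_def[symmetric] PiE_def Pi_def)
    qed
    also have "card \<dots> = (\<Sum>S\<in>?P. card (onto S))"
      by (rule card_UN_disjoint)
        (use finP fin_onto in \<open>auto simp: onto_def dest: finite_subset\<close>)
    also have "\<dots> = (\<Sum>S\<in>?P. s (card S))"
      by (intro sum.cong refl card_onto) (auto dest: finite_subset)
    also have "\<dots> = (\<Sum>i\<le>card V. \<Sum>S\<in>{S\<in>?P. card S = i}. s (card S))"
      by (rule sum.group[symmetric]) (use finP in auto)
    also have "\<dots> = (\<Sum>i\<le>card V. (n choose i) * s i)"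
    proof (rule sum.cong)
      fix i assume i: "i \<in> {..card V}"
      have "{S\<in>?P. card S = i} = {S. S \<subseteq> {..<n} \<and> card S = i}"
        using i by auto
      moreover have "card {S. S \<subseteq> {..<n} \<and> card S = i} = n choose i"
        by (simp add: n_subsets)
      ultimately show "(\<Sum>S\<in>{S\<in>?P. card S = i}. s (card S)) = (n choose i) * s i"
        by simp
    qed simp
    finally show ?thesis .
  qed
  define b :: "nat \<Rightarrow> rat poly" where
    "b i = smult (1 / fact i) (\<Prod>j = 0..<i. [:- of_nat j, 1:])" for i
  have b: "poly (b i) (of_nat n) = of_nat (n choose i)" for i n
    by (simp add: b_def poly_prod binomial_gbinomial gbinomial_prod_rev)
  have "poly (\<Sum>i\<le>card V. smult (of_nat (s i)) (b i)) (of_nat n)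
      = of_nat (card (proper_colorings G n))" for n
    by (simp add: poly_sum b count mult.commute)
  then show ?thesis by blast
qed

lemma poly_chromatic_poly:
  assumes "pair_graph G"
  shows "poly (chromatic_poly G) (of_nat n) = of_nat (card (proper_colorings G n))"
proof -
  have fin: "finite (pverts G)" and wf: "parcs G \<subseteq> pverts G \<times> pverts G"
    using assms by (auto simp: pair_graph_iff)
  obtain p :: "rat poly" where
    p: "\<forall>n. poly p (of_nat n) = of_nat (card (proper_colorings G n))"
    using chromatic_poly_exists[OF fin wf] by blast
  have "\<forall>n. poly (chromatic_poly G) (of_nat n) = of_nat (card (proper_colorings G n))"
    unfolding chromatic_poly_def
    by (rule theI[of _ p], rule p) (metis p rat_poly_eqI_of_nat)
  then show ?thesis by blast
qed

section \<open>Two-level polynomials\<close>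

definition numerical_poly :: "rat poly \<Rightarrow> bool" where
  "numerical_poly g \<longleftrightarrow> (\<forall>q :: int. poly g (of_int q) \<in> \<int>)"

definition eventually_nonneg :: "rat poly \<Rightarrow> bool" where
  "eventually_nonneg g \<longleftrightarrow> (\<forall>\<^sub>F q :: nat in sequentially. poly g (of_nat q) \<ge> 0)"

definition nonneg_args :: "rat poly \<Rightarrow> nat set" where
  "nonneg_args g = {q. poly g (of_nat q) \<ge> 0}"

text \<open>The coefficient \<open>c\<^sub>r\<close> in \<open>p(n) = (\<Sum>r. c\<^sub>r n\<^bsup>deg p - r\<^esup>)\<close>.\<close>

definition coeff_from_top :: "'a :: zero poly \<Rightarrow> nat \<Rightarrow> 'a" where
  "coeff_from_top p r = (if r \<le> degree p then coeff p (degree p - r) else 0)"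

text \<open>
  The sequence \<open>f\<close> and the depth function \<open>e\<close> are total functions on the natural numbers,
  but only their values on \<^term>\<open>nonneg_args g\<close> matter.  The condition
  \<open>f q \<noteq> 0\<close> is needed because \<^term>\<open>degree 0 = 0\<close>.
\<close>

definition two_level_poly ::
    "rat poly \<Rightarrow> (nat \<Rightarrow> ereal) \<Rightarrow> (nat \<Rightarrow> rat poly) \<Rightarrow> bool" where
  "two_level_poly g e f \<longleftrightarrow>
     numerical_poly g \<and> eventually_nonneg g \<and>
     (\<forall>q \<in> nonneg_args g. e q \<in> {-1, \<infinity>} \<union> range (\<lambda>m :: nat. ereal (real m))) \<and>
     (\<forall>q \<in> nonneg_args g. f q \<noteq> 0 \<and> of_nat (degree (f q)) = poly g (of_nat q)) \<and>
     (\<exists>\<phi> :: nat \<Rightarrow> rat poly. \<forall>q \<in> nonneg_args g. \<forall>r :: nat.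
        ereal (real r) \<le> e q \<longrightarrow> coeff_from_top (f q) r = poly (\<phi> r) (of_nat q))"

end

theory Submission
  imports Defs "HOL-Number_Theory.Cong"
begin

text \<open>
By Whitney's expansion the coefficient of \<open>n\<^bsup>|V| - r\<^esup>\<close> in the chromatic polynomial of a graph
on \<open>V\<close> is the signed number of arc sets of rank \<open>r\<close>, where the rank of an arc set is the number of
vertices minus the number of components (\<open>whitney_expansion\<close>, \<open>coeff_from_top_chromatic_poly\<close>).  The
only set of rank \<open>0\<close> is the empty one, so the polynomial is monic of degree \<open>|V| = q\<^sup>k\<close>.  It remains
to see that for fixed \<open>r\<close> the signed number is a polynomial in \<open>q\<close> as long as \<open>q \<ge> r + 2\<close>.

An arc set of rank \<open>r\<close> meets at most \<open>2 r\<close> vertices (\<open>card_Field_rank_sets\<close>).  Labelling these vertices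
expresses the coefficient through finitely many patterns, independent of \<open>q\<close>, and the numbers of
injective homomorphisms from these patterns to the torus (\<open>rank_sets_sum_patterns\<close>).
Inclusion-exclusion over the pairs of vertices that collide replaces the injective homomorphisms
from a pattern by all homomorphisms from its quotients (\<open>card_injective_homs\<close>), and quotients have no
larger rank (\<open>rank_image_le\<close>).

A cycle that winds around the torus has at least \<open>q\<close> arcs and therefore rank at least \<open>q - 1\<close>.  So a
homomorphism from a pattern of rank at most \<open>q - 2\<close> lifts to the integer lattice (\<open>lift_exists\<close>).  The
lift is unique once the image of one vertex of each component is fixed.  Hence there are
\<open>C \<cdot> (q\<^sup>k)\<^sup>c\<close> homomorphisms from a pattern with \<open>c\<close> components, where \<open>C\<close> counts lifts that start
at the origin and does not depend on \<open>q\<close> (\<open>card_homs_torus\<close>).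
\<close>

section \<open>Equivalence closures and class counts\<close>

text \<open>
Sets of arcs are treated as relations; the vertex sets of the connected components are the
classes of the generated equivalence relation.  Choosing a representative of each class turns
the number of components of \<open>B\<close> on \<open>U\<close> into \<open>card (class_rep B ` U)\<close>, and it turns the contraction
of \<open>B\<close> into an ordinary map.  The rank of \<open>B\<close> on \<open>U\<close> is \<open>card U - card (class_rep B ` U)\<close>; to avoid
truncated subtraction, statements about ranks are written additively.
\<close>

definition linked :: "'a rel \<Rightarrow> 'a rel" where
  "linked B = (B \<union> B\<inverse>)\<^sup>*"

definition class_rep :: "'a rel \<Rightarrow> 'a \<Rightarrow> 'a" where
  "class_rep B x = (SOME y. (x, y) \<in> linked B)"

lemma linked_refl [simp, intro]: "(x, x) \<in> linked B"
  by (simp add: linked_def)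

lemma linked_sym: "(x, y) \<in> linked B \<Longrightarrow> (y, x) \<in> linked B"
  unfolding linked_def by (metis sym_Un_converse sym_rtrancl symE)

lemma linked_trans: "(x, y) \<in> linked B \<Longrightarrow> (y, z) \<in> linked B \<Longrightarrow> (x, z) \<in> linked B"
  unfolding linked_def by (rule rtrancl_trans)

lemma linked_base: "(x, y) \<in> B \<Longrightarrow> (x, y) \<in> linked B"
  by (auto simp: linked_def)

lemma linked_const:
  assumes "(x, y) \<in> linked B" and "\<And>x y. (x, y) \<in> B \<Longrightarrow> h x = h y"
  shows "h x = h y"
  using assms(1) unfolding linked_def by (induction rule: rtrancl_induct) (auto dest: assms(2))

lemma linked_least:
  assumes "(x, y) \<in> linked B" and "\<And>x y. (x, y) \<in> B \<Longrightarrow> (x, y) \<in> linked C"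
  shows "(x, y) \<in> linked C"
  using assms(1) unfolding linked_def[of B]
  by (induction rule: rtrancl_induct) (auto dest: assms(2) linked_sym intro: linked_trans)

lemma linked_mono: "A \<subseteq> B \<Longrightarrow> (x, y) \<in> linked A \<Longrightarrow> (x, y) \<in> linked B"
  by (erule linked_least) (auto intro: linked_base)

lemma linked_outside:
  assumes "(x, y) \<in> linked B" "B \<subseteq> U \<times> U"
  shows "x = y \<or> x \<in> U \<and> y \<in> U"
  using assms(1) unfolding linked_def
  by (induction rule: rtrancl_induct) (use assms(2) in auto)

lemma linked_empty [simp]: "(x, y) \<in> linked {} \<longleftrightarrow> x = y"
  by (auto simp: linked_def)

lemma linked_insert:
  "(x, y) \<in> linked (insert (i, j) B) \<longleftrightarrow>
     (x, y) \<in> linked B \<or> (x, i) \<in> linked B \<and> (j, y) \<in> linked B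
       \<or> (x, j) \<in> linked B \<and> (i, y) \<in> linked B" (is "?L \<longleftrightarrow> ?R x y")
proof
  assume ?L
  then show "?R x y"
    unfolding linked_def[of "insert _ _"]
  proof (induction rule: rtrancl_induct)
    case base
    show ?case by simp
  next
    case (step y z)
    then have "(y, z) \<in> linked B \<or> y = i \<and> z = j \<or> y = j \<and> z = i"
      by (auto intro: linked_base linked_sym)
    with step.IH show ?case
      by (meson linked_refl linked_sym linked_trans)
  qed
next
  assume "?R x y"
  moreover have "(u, v) \<in> linked (insert (i, j) B)" if "(u, v) \<in> linked B" for u v
    using that by (rule linked_mono[rotated]) auto
  moreover have "(i, j) \<in> linked (insert (i, j) B)"
    by (rule linked_base) simp
  ultimately show ?L
    by (meson linked_sym linked_trans)
qed

lemma class_rep_linked: "(x, class_rep B x) \<in> linked B"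
  unfolding class_rep_def by (rule someI[of _ x]) simp

lemma class_rep_eq_iff: "class_rep B x = class_rep B y \<longleftrightarrow> (x, y) \<in> linked B"
proof
  assume "class_rep B x = class_rep B y"
  then show "(x, y) \<in> linked B"
    by (metis class_rep_linked linked_sym linked_trans)
next
  assume "(x, y) \<in> linked B"
  then have "(x, z) \<in> linked B \<longleftrightarrow> (y, z) \<in> linked B" for z
    by (meson linked_sym linked_trans)
  then show "class_rep B x = class_rep B y"
    by (simp add: class_rep_def)
qed

lemma class_rep_idem [simp]: "class_rep B (class_rep B x) = class_rep B x"
  by (metis class_rep_eq_iff class_rep_linked)

lemma class_rep_base: "(x, y) \<in> B \<Longrightarrow> class_rep B x = class_rep B y"
  by (simp add: class_rep_eq_iff linked_base)

lemma class_rep_empty [simp]: "class_rep {} x = x"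
  using class_rep_linked[of x "{}"] by simp

lemma class_rep_in: "B \<subseteq> U \<times> U \<Longrightarrow> x \<in> U \<Longrightarrow> class_rep B x \<in> U"
  using linked_outside[OF class_rep_linked] by metis

lemma class_rep_outside: "B \<subseteq> U \<times> U \<Longrightarrow> x \<notin> U \<Longrightarrow> class_rep B x = x"
  using linked_outside[OF class_rep_linked] by metis

lemma class_rep_of_subset: "A \<subseteq> B \<Longrightarrow> class_rep B (class_rep A x) = class_rep B x"
  by (metis class_rep_eq_iff class_rep_linked linked_mono linked_sym)

lemma class_count_antimono:
  assumes "finite U" "A \<subseteq> B"
  shows "card (class_rep B ` U) \<le> card (class_rep A ` U)"
proof -
  have "class_rep B ` U = class_rep B ` class_rep A ` U"
    using class_rep_of_subset[OF assms(2)] by (auto simp: image_image)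
  then show ?thesis
    using assms(1) by (simp add: card_image_le)
qed

text \<open>
A new arc merges at most two classes: away from the class of \<open>j\<close>, distinct old representatives stay
inequivalent.
\<close>

lemma class_count_insert_ge:
  assumes "finite U"
  shows "card (class_rep B ` U) \<le> Suc (card (class_rep (insert (i, j) B) ` U))"
proof -
  let ?B' = "insert (i, j) B"
  let ?R = "class_rep B ` U - {class_rep B j}"
  have "inj_on (class_rep ?B') ?R"
  proof (rule inj_onI)
    fix x y
    assume xy: "x \<in> ?R" "y \<in> ?R" and eq: "class_rep ?B' x = class_rep ?B' y"
    have fixed: "class_rep B x = x" "class_rep B y = y"
      using xy by auto
    have "(x, j) \<notin> linked B" "(y, j) \<notin> linked B"
      using xy fixed by (auto simp flip: class_rep_eq_iff)
    then have "(x, y) \<in> linked B"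
      using eq by (auto simp: class_rep_eq_iff linked_insert dest: linked_sym)
    then show "x = y"
      using fixed by (simp flip: class_rep_eq_iff)
  qed
  moreover have "class_rep ?B' ` ?R \<subseteq> class_rep ?B' ` U"
    using class_rep_of_subset[of B "insert (i, j) B", OF subset_insertI] by auto
  ultimately have "card ?R \<le> card (class_rep ?B' ` U)"
    using assms by (intro card_inj_on_le[of "class_rep ?B'"]) auto
  moreover have "card (class_rep B ` U) \<le> Suc (card ?R)"
    using diff_card_le_card_Diff[of "{class_rep B j}" "class_rep B ` U"] by simp
  ultimately show ?thesis by simp
qed

lemma class_count_insert_less:
  assumes "finite U" "i \<in> U" "j \<in> U" "(i, j) \<notin> linked B"
  shows "card (class_rep (insert (i, j) B) ` U) < card (class_rep B ` U)"
proof -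
  let ?B' = "insert (i, j) B"
  have eq: "class_rep ?B' ` U = class_rep ?B' ` class_rep B ` U"
    using class_rep_of_subset[of B "insert (i, j) B", OF subset_insertI] by (auto simp: image_image)
  have "class_rep ?B' (class_rep B i) = class_rep ?B' (class_rep B j)"
    using class_rep_of_subset[of B "insert (i, j) B", OF subset_insertI] class_rep_base[of i j ?B'] by auto
  moreover have "class_rep B i \<noteq> class_rep B j"
    using assms(4) by (simp add: class_rep_eq_iff)
  ultimately have "\<not> inj_on (class_rep ?B') (class_rep B ` U)"
    using assms(2,3) by (meson imageI inj_onD)
  then show ?thesis
    unfolding eq using assms(1)
    by (meson card_image_le eq_card_imp_inj_on finite_imageI le_neq_implies_less)
qed

lemma class_count_ge:
  assumes "finite U" "finite F"
  shows "card U \<le> card F + card (class_rep F ` U)"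
  using assms(2)
proof (induction F rule: finite_induct)
  case empty
  show ?case by simp
next
  case (insert e F)
  then show ?case
    using class_count_insert_ge[OF assms(1), of F "fst e" "snd e"] by simp
qed

text \<open>
Scanning the arcs and keeping only those that join two different classes leaves \<open>F\<close>; each kept
arc lowers the class count, so \<open>F\<close> has at most as many arcs as the rank of \<open>B\<close>.
\<close>

lemma spanning_forest_exists:
  assumes "finite U" "finite B" "B \<subseteq> U \<times> U"
  shows "\<exists>F\<subseteq>B. linked F = linked B \<and> card F + card (class_rep F ` U) \<le> card U"
  using assms(2,3)
proof (induction B rule: finite_induct)
  case empty
  show ?case using assms(1) by (auto simp: card_image_le)
next
  case (insert e B)
  obtain i j where e: "e = (i, j)" by (cases e)
  obtain F where F: "F \<subseteq> B" "linked F = linked B"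
      "card F + card (class_rep F ` U) \<le> card U"
    using insert by auto
  have ins: "linked (insert e F) = linked (insert e B)"
    using F(2) by (auto simp: e linked_insert)
  show ?case
  proof (cases "(i, j) \<in> linked B")
    case True
    have "(x, y) \<in> linked (insert e B) \<longleftrightarrow> (x, y) \<in> linked B" for x y
      unfolding e linked_insert using True by (meson linked_sym linked_trans)
    then have "linked (insert e B) = linked B"
      by auto
    with F show ?thesis by auto
  next
    case False
    then have "card (class_rep (insert e F) ` U) < card (class_rep F ` U)"
      unfolding e using insert.prems assms(1) F(2) by (intro class_count_insert_less) (auto simp: e)
    moreover have "card (insert e F) \<le> Suc (card F)"
      by (simp add: card_insert_le_m1)
    ultimately show ?thesis
      using F ins by (intro exI[of _ "insert e F"]) auto
  qed
qed

text \<open>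
The rank does not grow when vertices are identified: the image of a spanning forest still generates
the image of \<open>B\<close>, it has no more arcs than the forest, and a set of arcs has at most as much rank as
it has elements.
\<close>

lemma rank_image_le:
  assumes "finite U" "B \<subseteq> U \<times> U"
  shows "card (f ` U) + card (class_rep B ` U)
    \<le> card U + card (class_rep (map_prod f f ` B) ` f ` U)"
proof -
  have "finite B"
    using assms by (meson finite_SigmaI finite_subset)
  then obtain F where F: "F \<subseteq> B" "linked F = linked B"
      "card F + card (class_rep F ` U) \<le> card U"
    using spanning_forest_exists[OF assms(1) _ assms(2)] by blast
  have finF: "finite F"
    using F(1) \<open>finite B\<close> by (rule finite_subset)
  have fF: "linked (map_prod f f ` F) = linked (map_prod f f ` B)"
  proof (intro set_eqI iffI; clarify)
    fix x y assume "(x, y) \<in> linked (map_prod f f ` F)"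
    then show "(x, y) \<in> linked (map_prod f f ` B)"
      by (rule linked_mono[rotated]) (use F(1) in auto)
  next
    have img: "(f u, f v) \<in> linked (map_prod f f ` F)" if "(u, v) \<in> linked F" for u v
    proof -
      have "class_rep (map_prod f f ` F) (f u) = class_rep (map_prod f f ` F) (f v)"
        by (rule linked_const[OF that]) (force intro: class_rep_base)
      then show ?thesis by (simp add: class_rep_eq_iff)
    qed
    fix x y assume "(x, y) \<in> linked (map_prod f f ` B)"
    then show "(x, y) \<in> linked (map_prod f f ` F)"
    proof (rule linked_least)
      fix x y assume "(x, y) \<in> map_prod f f ` B"
      then obtain u v where "x = f u" "y = f v" "(u, v) \<in> B" by auto
      then show "(x, y) \<in> linked (map_prod f f ` F)"
        using img F(2) linked_base by metis
    qed
  qed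
  have "card (f ` U) \<le> card (map_prod f f ` F) + card (class_rep (map_prod f f ` F) ` f ` U)"
    using assms(1) finF by (intro class_count_ge) auto
  also have "card (map_prod f f ` F) \<le> card F"
    using finF by (rule card_image_le)
  also have "class_rep (map_prod f f ` F) = class_rep (map_prod f f ` B)"
    by (simp add: class_rep_def fun_eq_iff fF)
  finally show ?thesis
    using F(2,3) by (simp add: class_rep_def[abs_def])
qed

lemma class_count_inj_image:
  assumes "finite U" "B \<subseteq> U \<times> U" "inj_on f U"
  shows "card (class_rep (map_prod f f ` B) ` f ` U) = card (class_rep B ` U)"
proof (rule antisym)
  have cU: "card (f ` U) = card U"
    using assms(3) by (rule card_image)
  show "card (class_rep B ` U) \<le> card (class_rep (map_prod f f ` B) ` f ` U)"
    using rank_image_le[OF assms(1,2), of f] cU by simp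
  let ?g = "the_inv_into U f"
  have gU: "?g ` f ` U = U" and g: "\<And>x. x \<in> U \<Longrightarrow> ?g (f x) = x"
    using assms(3) by (auto simp: the_inv_into_f_f image_image)
  have "map_prod ?g ?g ` map_prod f f ` B = id ` B"
    unfolding image_image using assms(2) by (intro image_cong) (auto simp: g)
  then show "card (class_rep (map_prod f f ` B) ` f ` U) \<le> card (class_rep B ` U)"
    using rank_image_le[of "f ` U" "map_prod f f ` B" ?g] assms(1,2) cU gU by auto
qed

text \<open>
Isolated vertices do not change the rank, so it may be computed on the \<open>Field\<close> of a relation.
\<close>

lemma class_count_restrict:
  assumes "finite V" "W \<subseteq> V" "B \<subseteq> W \<times> W"
  shows "card (class_rep B ` V) + card W = card (class_rep B ` W) + card V"
proof -
  have "class_rep B ` V = class_rep B ` W \<union> (V - W)"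
  proof -
    have "class_rep B ` (V - W) = (\<lambda>x. x) ` (V - W)"
      by (intro image_cong refl class_rep_outside[OF assms(3)]) auto
    moreover have "V = W \<union> (V - W)"
      using assms(2) by auto
    ultimately show ?thesis
      by (metis image_Un image_ident)
  qed
  moreover have "class_rep B ` W \<subseteq> W"
    using class_rep_in[OF assms(3)] by auto
  moreover have "finite W"
    using assms(1,2) by (rule rev_finite_subset)
  ultimately have "card (class_rep B ` V) = card (class_rep B ` W) + (card V - card W)"
    using assms(1,2) by (subst card_Diff_subset[symmetric]) (auto intro!: card_Un_disjoint)
  then show ?thesis
    using card_mono[OF assms(1,2)] by linarith
qed

text \<open>
Without loops every class of a non-isolated vertex has at least two elements.  This bounds the
number of vertices met by a set of arcs by twice its rank.
\<close>

lemma card_Field_le: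
  assumes "finite A" "irrefl A"
  shows "2 * card (class_rep A ` Field A) \<le> card (Field A)"
proof -
  let ?R = "class_rep A ` Field A"
  have sub: "?R \<subseteq> Field A"
    by (intro image_subsetI class_rep_in) (auto simp: Field_def)
  have fin: "finite (Field A)"
    using assms(1) by (rule finite_Field)
  have "?R \<subseteq> class_rep A ` (Field A - ?R)"
  proof
    fix x assume x: "x \<in> ?R"
    then have rx: "class_rep A x = x" by auto
    obtain y where y: "(x, y) \<in> A \<or> (y, x) \<in> A"
      using x sub by (force simp: Field_def)
    then have "x \<noteq> y" "y \<in> Field A"
      using assms(2) by (auto simp: irrefl_def Field_def)
    moreover have "class_rep A y = x"
      using y rx class_rep_base by metis
    moreover have "y \<notin> ?R"
      using calculation by auto
    ultimately show "x \<in> class_rep A ` (Field A - ?R)" by blast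
  qed
  then have "card ?R \<le> card (Field A - ?R)"
    using fin by (meson card_image_le card_mono finite_Diff finite_imageI order_trans)
  also have "\<dots> = card (Field A) - card ?R"
    using sub fin by (intro card_Diff_subset) auto
  finally show ?thesis by simp
qed

section \<open>The chromatic polynomial as a signed sum over arc sets\<close>

text \<open>
The form of inclusion-exclusion used twice below: once for the condition that adjacent vertices get
different colors, and once for the condition that a homomorphism is injective.
\<close>

lemma inclusion_exclusion_avoid:
  assumes "finite E" "finite X"
  shows "of_nat (card {c \<in> X. \<forall>e\<in>E. \<not> P e c})
    = (\<Sum>A\<in>Pow E. (-1) ^ card A * (of_nat (card {c \<in> X. \<forall>e\<in>A. P e c}) :: 'b :: comm_ring_1))"
  using assms
proof (induction E arbitrary: X rule: finite_induct)
  case empty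
  show ?case by simp
next
  case (insert e E)
  let ?f = "\<lambda>X A. (-1) ^ card A * (of_nat (card {c \<in> X. \<forall>e\<in>A. P e c}) :: 'b)"
  let ?N = "\<lambda>X. {c \<in> X. \<forall>e\<in>E. \<not> P e c}"
  let ?X1 = "{c \<in> X. P e c}"
  have "?N X = {c \<in> X. \<forall>e\<in>insert e E. \<not> P e c} \<union> ?N ?X1"
    by auto
  then have "card (?N X) = card {c \<in> X. \<forall>e\<in>insert e E. \<not> P e c} + card (?N ?X1)"
    using insert.prems by (auto intro!: card_Un_disjoint)
  then have "of_nat (card {c \<in> X. \<forall>e\<in>insert e E. \<not> P e c})
      = (of_nat (card (?N X)) - of_nat (card (?N ?X1)) :: 'b)"
    by simp
  also have "\<dots> = (\<Sum>A\<in>Pow E. ?f X A) - (\<Sum>A\<in>Pow E. ?f ?X1 A)"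
  proof -
    have "finite ?X1"
      using insert.prems by simp
    then show ?thesis
      by (simp only: insert.IH[OF insert.prems] insert.IH[of ?X1])
  qed
  also have "(\<Sum>A\<in>Pow E. ?f ?X1 A) = - (\<Sum>A\<in>Pow E. ?f X (insert e A))"
    unfolding sum_negf[symmetric]
  proof (rule sum.cong)
    fix A assume "A \<in> Pow E"
    then have "card (insert e A) = Suc (card A)"
      using insert.hyps by (auto intro!: card_insert_disjoint dest: finite_subset)
    moreover have "{c \<in> ?X1. \<forall>e\<in>A. P e c} = {c \<in> X. \<forall>e\<in>insert e A. P e c}"
      by auto
    ultimately show "?f ?X1 A = - ?f X (insert e A)"
      by simp
  qed simp
  also have "(\<Sum>A\<in>Pow E. ?f X (insert e A)) = (\<Sum>A\<in>insert e ` Pow E. ?f X A)"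
    using insert.hyps by (subst sum.reindex) (auto intro!: inj_onI)
  also have "(\<Sum>A\<in>Pow E. ?f X A) - - (\<Sum>A\<in>insert e ` Pow E. ?f X A)
      = (\<Sum>A\<in>Pow (insert e E). ?f X A)"
    unfolding Pow_insert using insert.hyps by (subst sum.union_disjoint) auto
  finally show ?case .
qed

text \<open>
A function that is constant along \<open>B\<close> is the same as a function on the contraction of \<open>B\<close>.
\<close>

lemma bij_betw_constant_functions:
  assumes "B \<subseteq> U \<times> U"
  shows "bij_betw (\<lambda>c. \<lambda>x\<in>U. c (class_rep B x)) (class_rep B ` U \<rightarrow>\<^sub>E S)
           {c \<in> U \<rightarrow>\<^sub>E S. \<forall>(x, y)\<in>B. c x = c y}"
proof (rule bij_betw_byWitness[where f' = "\<lambda>c. restrict c (class_rep B ` U)"])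
  have in_U: "class_rep B x \<in> U" if "x \<in> U" for x
    using class_rep_in[OF assms that] .
  show "\<forall>c\<in>class_rep B ` U \<rightarrow>\<^sub>E S. restrict (\<lambda>x\<in>U. c (class_rep B x)) (class_rep B ` U) = c"
  proof
    fix c assume c: "c \<in> class_rep B ` U \<rightarrow>\<^sub>E S"
    show "restrict (\<lambda>x\<in>U. c (class_rep B x)) (class_rep B ` U) = c"
      by (rule extensionalityI[of _ "class_rep B ` U"]) (use c in_U in \<open>auto simp: PiE_def\<close>)
  qed
  have "c (class_rep B x) = c x" if "\<forall>(x, y)\<in>B. c x = c y" for c :: "'a \<Rightarrow> 'b" and x
    by (rule linked_const[OF linked_sym[OF class_rep_linked[of x B]]]) (use that in auto)
  then show "\<forall>c\<in>{c \<in> U \<rightarrow>\<^sub>E S. \<forall>(x, y)\<in>B. c x = c y}.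
      (\<lambda>x\<in>U. restrict c (class_rep B ` U) (class_rep B x)) = c"
    by (intro ballI extensionalityI[of _ U]) (auto simp: PiE_def)
  show "(\<lambda>c. \<lambda>x\<in>U. c (class_rep B x)) ` (class_rep B ` U \<rightarrow>\<^sub>E S)
      \<subseteq> {c \<in> U \<rightarrow>\<^sub>E S. \<forall>(x, y)\<in>B. c x = c y}"
  proof (intro image_subsetI CollectI conjI ballI; clarify?)
    fix c assume c: "c \<in> class_rep B ` U \<rightarrow>\<^sub>E S"
    then show "(\<lambda>x\<in>U. c (class_rep B x)) \<in> U \<rightarrow>\<^sub>E S" by auto
    fix x y assume "(x, y) \<in> B"
    then show "(\<lambda>x\<in>U. c (class_rep B x)) x = (\<lambda>x\<in>U. c (class_rep B x)) y"
      using assms class_rep_base[of x y B] by auto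
  qed
  show "(\<lambda>c. restrict c (class_rep B ` U)) ` {c \<in> U \<rightarrow>\<^sub>E S. \<forall>(x, y)\<in>B. c x = c y}
      \<subseteq> class_rep B ` U \<rightarrow>\<^sub>E S"
    using in_U by auto
qed

lemma card_constant_functions:
  assumes "finite U" "B \<subseteq> U \<times> U"
  shows "card {c \<in> U \<rightarrow>\<^sub>E S. \<forall>(x, y)\<in>B. c x = c y} = card S ^ card (class_rep B ` U)"
  using bij_betw_same_card[OF bij_betw_constant_functions[OF assms(2), of S]] assms(1)
  by (simp add: card_funcsetE)

text \<open>
Whitney's expansion, by inclusion-exclusion over the arcs whose ends get equal colors.  Each
undirected edge contributes its two arcs as separate events; inclusion-exclusion allows such
repetitions, and so no choice of an orientation is needed.
\<close>

lemma whitney_expansion: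
  assumes "pair_graph G"
  shows "chromatic_poly G
    = (\<Sum>A\<in>Pow (parcs G). monom ((-1) ^ card A) (card (class_rep A ` pverts G)))"
proof (rule rat_poly_eqI_of_nat)
  fix n :: nat
  have finV: "finite (pverts G)" and wf: "parcs G \<subseteq> pverts G \<times> pverts G"
    using assms by (auto simp: pair_graph_iff)
  have finE: "finite (parcs G)"
    using finV wf by (meson finite_SigmaI finite_subset)
  have "of_nat (card (proper_colorings G n))
      = of_nat (card {c \<in> pverts G \<rightarrow>\<^sub>E {..<n}. \<forall>e\<in>parcs G. \<not> c (fst e) = c (snd e)})"
    by (auto simp: proper_colorings_def case_prod_beta)
  also have "\<dots> = (\<Sum>A\<in>Pow (parcs G). (-1) ^ card A *
      of_nat (card {c \<in> pverts G \<rightarrow>\<^sub>E {..<n}. \<forall>e\<in>A. c (fst e) = c (snd e)}) :: rat)"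
    by (rule inclusion_exclusion_avoid) (use finE finV in \<open>auto intro!: finite_PiE\<close>)
  also have "\<dots> = (\<Sum>A\<in>Pow (parcs G). (-1) ^ card A * of_nat n ^ card (class_rep A ` pverts G))"
  proof (rule sum.cong)
    fix A assume "A \<in> Pow (parcs G)"
    then have "A \<subseteq> pverts G \<times> pverts G" using wf by auto
    from card_constant_functions[OF finV this, of "{..<n}"]
    show "(-1) ^ card A * of_nat (card {c \<in> pverts G \<rightarrow>\<^sub>E {..<n}. \<forall>e\<in>A. c (fst e) = c (snd e)})
        = (-1 :: rat) ^ card A * of_nat n ^ card (class_rep A ` pverts G)"
      by (simp add: case_prod_beta)
  qed simp
  finally show "poly (chromatic_poly G) (of_nat n) = poly (\<Sum>A\<in>Pow (parcs G).
      monom ((-1) ^ card A) (card (class_rep A ` pverts G))) (of_nat n)"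
    using assms by (simp add: poly_chromatic_poly poly_sum poly_monom)
qed

section \<open>Coefficients from the top\<close>

definition rank_sets :: "'a pair_pre_digraph \<Rightarrow> nat \<Rightarrow> 'a rel set" where
  "rank_sets G r = {A. A \<subseteq> parcs G \<and> card (class_rep A ` pverts G) + r = card (pverts G)}"

lemma rank_sets_0:
  assumes "pair_graph G"
  shows "rank_sets G 0 = {{}}"
proof -
  have "A = {}" if A: "A \<in> rank_sets G 0" for A
  proof (rule ccontr)
    assume "A \<noteq> {}"
    then obtain x y where xy: "(x, y) \<in> A" by auto
    have "inj_on (class_rep A) (pverts G)"
      using A assms by (intro eq_card_imp_inj_on) (auto simp: rank_sets_def pair_graph_iff)
    moreover have "x \<in> pverts G" "y \<in> pverts G" "x \<noteq> y"
      using xy A assms by (auto simp: rank_sets_def pair_graph_iff)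
    ultimately show False
      using class_rep_base[OF xy] by (auto dest: inj_onD)
  qed
  moreover have "{} \<in> rank_sets G 0"
    by (simp add: rank_sets_def)
  ultimately show ?thesis by auto
qed

lemma coeff_chromatic_poly:
  assumes "pair_graph G"
  shows "coeff (chromatic_poly G) m
    = (\<Sum>A\<in>{A. A \<subseteq> parcs G \<and> card (class_rep A ` pverts G) = m}. (-1) ^ card A)"
proof -
  have "finite (pverts G \<times> pverts G)" "parcs G \<subseteq> pverts G \<times> pverts G"
    using assms by (auto simp: pair_graph_iff)
  then have "finite (parcs G)"
    by (rule rev_finite_subset)
  then show ?thesis
    unfolding whitney_expansion[OF assms] coeff_sum coeff_monom
    by (subst sum.inter_filter[symmetric]) (auto intro!: sum.cong)
qed

lemma degree_chromatic_poly:
  assumes "pair_graph G"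
  shows "degree (chromatic_poly G) = card (pverts G)" "chromatic_poly G \<noteq> 0"
proof -
  have fin: "finite (pverts G)"
    using assms by (simp add: pair_graph_iff)
  have "coeff (chromatic_poly G) (card (pverts G)) = (\<Sum>A\<in>rank_sets G 0. (-1) ^ card A)"
    unfolding coeff_chromatic_poly[OF assms] rank_sets_def by simp
  then have top: "coeff (chromatic_poly G) (card (pverts G)) = 1"
    by (simp add: rank_sets_0[OF assms])
  then show "chromatic_poly G \<noteq> 0" by auto
  have "coeff (chromatic_poly G) m = 0" if "m > card (pverts G)" for m
  proof -
    have "card (class_rep A ` pverts G) \<noteq> m" for A
      using card_image_le[OF fin, of "class_rep A"] that by linarith
    then show ?thesis
      by (simp add: coeff_chromatic_poly[OF assms])
  qed
  then have "degree (chromatic_poly G) \<le> card (pverts G)"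
    by (intro degree_le) auto
  moreover have "card (pverts G) \<le> degree (chromatic_poly G)"
    using top by (intro le_degree) auto
  ultimately show "degree (chromatic_poly G) = card (pverts G)" by simp
qed

lemma coeff_from_top_chromatic_poly:
  assumes "pair_graph G"
  shows "coeff_from_top (chromatic_poly G) r = (\<Sum>A\<in>rank_sets G r. (-1) ^ card A)"
proof (cases "r \<le> card (pverts G)")
  case True
  then have "{A. A \<subseteq> parcs G \<and> card (class_rep A ` pverts G) = card (pverts G) - r} = rank_sets G r"
    by (auto simp: rank_sets_def)
  with True show ?thesis
    by (simp add: coeff_from_top_def degree_chromatic_poly[OF assms] coeff_chromatic_poly[OF assms])
next
  case False
  then have "rank_sets G r = {}"
    by (auto simp: rank_sets_def)
  with False show ?thesis
    by (simp add: coeff_from_top_def degree_chromatic_poly[OF assms])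
qed

section \<open>Reduction to homomorphism counts\<close>

definition homs :: "'a pair_pre_digraph \<Rightarrow> 'b set \<Rightarrow> 'b rel \<Rightarrow> ('b \<Rightarrow> 'a) set" where
  "homs G U B = {f \<in> U \<rightarrow>\<^sub>E pverts G. \<forall>(x, y)\<in>B. (f x, f y) \<in> parcs G}"

text \<open>
The possible shapes, on the labels \<open>0, ..., u - 1\<close>, of a set of arcs of rank \<open>r\<close> that meets \<open>u\<close>
vertices.
\<close>

definition patterns :: "nat \<Rightarrow> nat \<Rightarrow> nat rel set" where
  "patterns u r = {B. B \<subseteq> {..<u} \<times> {..<u} \<and> Field B = {..<u}
                      \<and> card (class_rep B ` {..<u}) + r = u}"

lemma card_injections:
  assumes "finite S" "card S = u"
  shows "card {f \<in> {..<u} \<rightarrow>\<^sub>E S. inj_on f {..<u}} = fact u"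
  using card_inj_on_subset_funcset[of "{..<u}" S "{..<u}"] assms
  by (simp add: fact_prod_rev atLeast0LessThan)

text \<open>
Double counting of the pairs of a set \<open>A\<close> of arcs and a labelling of the \<open>u\<close> vertices that it meets.
For fixed \<open>A\<close> there are \<open>u!\<close> labellings; pulling \<open>A\<close> back along the labelling gives a pattern
together with an injective homomorphism from it.
\<close>

lemma rank_sets_sum_patterns:
  fixes G :: "'a pair_pre_digraph"
  assumes "pair_graph G"
  shows "fact u * (\<Sum>A\<in>{A \<in> rank_sets G r. card (Field A) = u}. (-1) ^ card A)
    = (\<Sum>B\<in>patterns u r. (-1) ^ card B * (of_nat (card {f \<in> homs G {..<u} B. inj_on f {..<u}}) :: rat))"
proof -
  have finV: "finite (pverts G)" and wf: "parcs G \<subseteq> pverts G \<times> pverts G"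
    using assms by (auto simp: pair_graph_iff)
  have finE: "finite (parcs G)"
    using finV wf by (meson finite_SigmaI finite_subset)
  let ?RS = "{A \<in> rank_sets G r. card (Field A) = u}"
  let ?I = "\<lambda>A. {f \<in> {..<u} \<rightarrow>\<^sub>E Field A. inj_on f {..<u}}"
  let ?H = "\<lambda>B. {f \<in> homs G {..<u} B. inj_on f {..<u}}"
  have finRS: "finite ?RS"
    by (rule finite_subset[of _ "Pow (parcs G)"]) (use finE in \<open>auto simp: rank_sets_def\<close>)
  have finP: "finite (patterns u r)"
    by (rule finite_subset[of _ "Pow ({..<u} \<times> {..<u})"]) (auto simp: patterns_def)
  have RS: "A \<subseteq> parcs G" "finite A" "finite (Field A)" "Field A \<subseteq> pverts G" "card (Field A) = u"
      "card (class_rep A ` Field A) + r = u" if "A \<in> ?RS" for A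
  proof -
    show A: "A \<subseteq> parcs G" "card (Field A) = u"
      using that by (auto simp: rank_sets_def)
    show "finite A" using A finE by (blast intro: finite_subset)
    then show "finite (Field A)" by (rule finite_Field)
    show sub: "Field A \<subseteq> pverts G" using A wf by (auto simp: Field_def)
    have "A \<subseteq> Field A \<times> Field A" by (auto simp: Field_def)
    from class_count_restrict[OF finV sub this]
    show "card (class_rep A ` Field A) + r = u"
      using that by (auto simp: rank_sets_def)
  qed
  have finI: "finite (?I A)" if "A \<in> ?RS" for A
    using RS[OF that] by (auto intro!: finite_PiE)
  have finH: "finite (?H B)" for B
    using finV by (auto simp: homs_def intro!: finite_PiE)
  have I_bij: "f ` {..<u} = Field A" if "A \<in> ?RS" "f \<in> ?I A" for f A
    using that RS[OF that(1)] by (intro card_subset_eq) (auto simp: card_image)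
  have "fact u * (\<Sum>A\<in>?RS. (-1) ^ card A) = (\<Sum>A\<in>?RS. \<Sum>f\<in>?I A. (-1 :: rat) ^ card A)"
    unfolding sum_distrib_left
  proof (rule sum.cong)
    fix A assume "A \<in> ?RS"
    then have "card (?I A) = fact u"
      by (intro card_injections RS)
    then show "fact u * (-1) ^ card A = (\<Sum>f\<in>?I A. (-1 :: rat) ^ card A)"
      by simp
  qed simp
  also have "\<dots> = (\<Sum>(A, f)\<in>Sigma ?RS ?I. (-1) ^ card A)"
    using finRS finI by (subst sum.Sigma) auto
  also have "\<dots> = (\<Sum>(B, f)\<in>Sigma (patterns u r) ?H. (-1) ^ card B)"
  proof (rule sum.reindex_bij_witness[where
        i = "\<lambda>(B, f). (map_prod f f ` B, f)" and
        j = "\<lambda>(A, f). ({(i, j). i < u \<and> j < u \<and> (f i, f j) \<in> A}, f)"])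
    fix a assume "a \<in> Sigma ?RS ?I"
    then obtain A f where a: "a = (A, f)" and A: "A \<in> ?RS" and f: "f \<in> ?I A" by auto
    note RS = RS[OF A]
    let ?B = "{(i, j). i < u \<and> j < u \<and> (f i, f j) \<in> A}"
    have img: "f ` {..<u} = Field A" using I_bij[OF A f] .
    have inj: "inj_on f {..<u}" using f by auto
    have fB: "map_prod f f ` ?B = A"
    proof (intro equalityI subsetI)
      fix e assume e: "e \<in> A"
      obtain x y where xy: "e = (x, y)" by (cases e)
      then have "x \<in> f ` {..<u}" "y \<in> f ` {..<u}"
        using e unfolding img by (auto simp: Field_def)
      then show "e \<in> map_prod f f ` ?B"
        using e xy by force
    qed auto
    have cardB: "card ?B = card A"
    proof -
      have "inj_on (map_prod f f) ({..<u} \<times> {..<u})"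
        using inj by (intro map_prod_inj_on)
      then have "inj_on (map_prod f f) ?B"
        by (rule inj_on_subset) auto
      from card_image[OF this] show ?thesis by (simp add: fB)
    qed
    have "card (class_rep ?B ` {..<u}) = card (class_rep A ` Field A)"
      using class_count_inj_image[OF _ _ inj, of ?B] by (fastforce simp: fB img)
    moreover have "Field ?B = {..<u}"
    proof (intro equalityI subsetI)
      fix i assume i: "i \<in> {..<u}"
      then have "f i \<in> Field A" using img by auto
      then obtain y where y: "(f i, y) \<in> A \<or> (y, f i) \<in> A" by (auto simp: Field_def)
      then have "y \<in> f ` {..<u}" unfolding img by (auto simp: Field_def)
      with y i show "i \<in> Field ?B" by (force simp: Field_def)
    qed (auto simp: Field_def)
    ultimately have "?B \<in> patterns u r"
      using RS by (auto simp: patterns_def)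
    moreover have "f \<in> ?H ?B"
      using f RS by (auto simp: homs_def)
    ultimately show "(case a of (A, f) \<Rightarrow> ({(i, j). i < u \<and> j < u \<and> (f i, f j) \<in> A}, f))
        \<in> Sigma (patterns u r) ?H"
      by (simp add: a)
    show "(case case a of (A, f) \<Rightarrow> ({(i, j). i < u \<and> j < u \<and> (f i, f j) \<in> A}, f)
        of (B, f) \<Rightarrow> (map_prod f f ` B, f)) = a"
      by (simp add: a fB)
    show "(case case a of (A, f) \<Rightarrow> ({(i, j). i < u \<and> j < u \<and> (f i, f j) \<in> A}, f)
        of (B, f) \<Rightarrow> (-1) ^ card B) = (case a of (A, f) \<Rightarrow> (-1 :: rat) ^ card A)"
      by (simp add: a cardB)
  next
    fix b assume "b \<in> Sigma (patterns u r) ?H"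
    then obtain B f where b: "b = (B, f)" and B: "B \<in> patterns u r" and f: "f \<in> ?H B" by auto
    let ?A = "map_prod f f ` B"
    have inj: "inj_on f {..<u}" using f by auto
    have BU: "B \<subseteq> {..<u} \<times> {..<u}" "Field B = {..<u}" "card (class_rep B ` {..<u}) + r = u"
      using B by (auto simp: patterns_def)
    have from_A: "(i, j) \<in> B" if "i < u" "j < u" "(f i, f j) \<in> ?A" for i j
    proof -
      from that(3) obtain e where "(f i, f j) = map_prod f f e" "e \<in> B"
        by (rule imageE)
      then obtain i' j' where ij: "(i', j') \<in> B" "f i = f i'" "f j = f j'"
        by (cases e) auto
      then have "i' < u" "j' < u" using BU by auto
      then have "i = i'" "j = j'" using inj ij that by (auto dest: inj_onD)
      with ij show ?thesis by simp
    qed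
    have B_eq: "{(i, j). i < u \<and> j < u \<and> (f i, f j) \<in> ?A} = B"
    proof (intro equalityI subsetI)
      fix e assume e: "e \<in> {(i, j). i < u \<and> j < u \<and> (f i, f j) \<in> ?A}"
      have "(fst e, snd e) \<in> B"
        by (rule from_A) (use e in \<open>simp_all only: mem_Collect_eq case_prod_beta\<close>)
      then show "e \<in> B" by simp
    next
      fix e assume e: "e \<in> B"
      then have "fst e < u \<and> snd e < u" using BU(1) by auto
      moreover have "(f (fst e), f (snd e)) \<in> ?A"
        using imageI[OF e, of "map_prod f f"] by (simp only: map_prod_def case_prod_beta)
      ultimately show "e \<in> {(i, j). i < u \<and> j < u \<and> (f i, f j) \<in> ?A}"
        by (simp only: mem_Collect_eq case_prod_beta simp_thms)
    qed
    have fld: "Field ?A = f ` {..<u}"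
      unfolding BU(2)[symmetric] by (force simp: Field_def)
    have sub: "?A \<subseteq> parcs G" "Field ?A \<subseteq> pverts G"
      using f fld by (auto simp: homs_def)
    have cF: "card (Field ?A) = u"
      using inj by (simp add: fld card_image)
    have "card (class_rep ?A ` Field ?A) + r = u"
      using class_count_inj_image[OF _ BU(1) inj] BU(3) by (simp add: fld)
    moreover have "?A \<subseteq> Field ?A \<times> Field ?A" by (auto simp: Field_def)
    from class_count_restrict[OF finV sub(2) this]
    have "card (class_rep ?A ` pverts G) + card (Field ?A)
        = card (class_rep ?A ` Field ?A) + card (pverts G)" .
    ultimately have "card (class_rep ?A ` pverts G) + r = card (pverts G)"
      using cF by linarith
    then have "?A \<in> ?RS"
      using sub cF by (simp add: rank_sets_def)
    moreover have "f \<in> ?I ?A"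
      using f by (auto simp: fld homs_def)
    ultimately show "(case b of (B, f) \<Rightarrow> (map_prod f f ` B, f)) \<in> Sigma ?RS ?I"
      by (simp add: b)
    show "(case case b of (B, f) \<Rightarrow> (map_prod f f ` B, f)
        of (A, f) \<Rightarrow> ({(i, j). i < u \<and> j < u \<and> (f i, f j) \<in> A}, f)) = b"
      by (simp add: b B_eq)
  qed
  also have "\<dots> = (\<Sum>B\<in>patterns u r. \<Sum>f\<in>?H B. (-1) ^ card B)"
    using finP finH by (subst sum.Sigma) auto
  finally show ?thesis
    by (simp add: mult.commute)
qed

lemma card_Field_rank_sets:
  assumes "pair_graph G" "A \<in> rank_sets G r"
  shows "card (Field A) \<le> 2 * r"
proof -
  have A: "A \<subseteq> parcs G" "finite (pverts G)" "Field A \<subseteq> pverts G"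
      "A \<subseteq> Field A \<times> Field A" "irrefl A"
    using assms by (auto simp: rank_sets_def pair_graph_iff Field_def irrefl_def)
  have "A \<subseteq> pverts G \<times> pverts G" using A(3,4) by auto
  then have finA: "finite A"
    using A(2) by (meson finite_SigmaI finite_subset)
  have "card (class_rep A ` Field A) + r = card (Field A)"
    using class_count_restrict[OF A(2-4)] assms(2) by (auto simp: rank_sets_def)
  then show ?thesis
    using card_Field_le[OF finA A(5)] by linarith
qed

text \<open>
Inclusion-exclusion over the set \<open>D\<close> of pairs that are required to collide.  The homomorphisms with
these collisions are the homomorphisms from the quotient by \<open>D\<close>.
\<close>

lemma card_injective_homs:
  fixes G :: "'a pair_pre_digraph"
  assumes "finite (pverts G)" "finite U" "B \<subseteq> U \<times> U"
  shows "of_nat (card {f \<in> homs G U B. inj_on f U})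
    = (\<Sum>D\<in>Pow {e \<in> U \<times> U. fst e \<noteq> snd e}. (-1) ^ card D *
        (of_nat (card (homs G (class_rep D ` U) (map_prod (class_rep D) (class_rep D) ` B))) :: 'b :: comm_ring_1))"
proof -
  let ?E = "{e \<in> U \<times> U. fst e \<noteq> snd e}"
  have finH: "finite (homs G U B)"
    using assms by (auto simp: homs_def intro!: finite_PiE)
  have "{f \<in> homs G U B. inj_on f U} = {f \<in> homs G U B. \<forall>e\<in>?E. \<not> f (fst e) = f (snd e)}"
    by (auto simp: inj_on_def)
  then have "of_nat (card {f \<in> homs G U B. inj_on f U})
    = (\<Sum>D\<in>Pow ?E. (-1) ^ card D *
        (of_nat (card {f \<in> homs G U B. \<forall>e\<in>D. f (fst e) = f (snd e)}) :: 'b))"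
    using assms(2) finH by (simp only:) (intro inclusion_exclusion_avoid, auto)
  also have "\<dots> = (\<Sum>D\<in>Pow ?E. (-1) ^ card D *
        of_nat (card (homs G (class_rep D ` U) (map_prod (class_rep D) (class_rep D) ` B))))"
  proof (rule sum.cong)
    fix D assume "D \<in> Pow ?E"
    then have D: "D \<subseteq> U \<times> U" by auto
    let ?ext = "\<lambda>c. \<lambda>x\<in>U. c (class_rep D x)"
    let ?H' = "homs G (class_rep D ` U) (map_prod (class_rep D) (class_rep D) ` B)"
    note bij = bij_betw_constant_functions[OF D, of "pverts G"]
    have mem: "?ext c \<in> homs G U B \<longleftrightarrow> c \<in> ?H'" if "c \<in> class_rep D ` U \<rightarrow>\<^sub>E pverts G" for c
    proof -
      have "?ext c \<in> U \<rightarrow>\<^sub>E pverts G"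
        using that by auto
      moreover have "(\<forall>(x, y)\<in>B. (?ext c x, ?ext c y) \<in> parcs G) \<longleftrightarrow>
          (\<forall>(x, y)\<in>B. (c (class_rep D x), c (class_rep D y)) \<in> parcs G)"
        using assms(3) by (intro ball_cong) auto
      ultimately show ?thesis
        using that by (auto simp: homs_def)
    qed
    have "bij_betw ?ext ?H' {f \<in> homs G U B. \<forall>e\<in>D. f (fst e) = f (snd e)}"
      unfolding bij_betw_def
    proof
      show "inj_on ?ext ?H'"
        using bij_betw_imp_inj_on[OF bij] by (rule inj_on_subset) (auto simp: homs_def)
      have "?ext ` ?H' = {f \<in> ?ext ` (class_rep D ` U \<rightarrow>\<^sub>E pverts G). f \<in> homs G U B}"
        using mem by (fastforce simp: homs_def)
      also have "\<dots> = {f \<in> homs G U B. \<forall>e\<in>D. f (fst e) = f (snd e)}"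
        unfolding bij_betw_imp_surj_on[OF bij] by (auto simp: homs_def)
      finally show "?ext ` ?H' = {f \<in> homs G U B. \<forall>e\<in>D. f (fst e) = f (snd e)}" .
    qed
    from bij_betw_same_card[OF this]
    show "(-1) ^ card D * of_nat (card {f \<in> homs G U B. \<forall>e\<in>D. f (fst e) = f (snd e)})
        = (-1) ^ card D * (of_nat (card ?H') :: 'b)"
      by simp
  qed simp
  finally show ?thesis .
qed

section \<open>The torus and its arcs modulo the side length\<close>

text \<open>
A step along an edge of the integer lattice.  Only the first \<open>k\<close> coordinates matter.
\<close>

definition unit_step :: "nat \<Rightarrow> (nat \<Rightarrow> int) \<Rightarrow> bool" where
  "unit_step k v \<longleftrightarrow> (\<exists>l<k. \<bar>v l\<bar> = 1 \<and> (\<forall>m<k. m \<noteq> l \<longrightarrow> v m = 0))"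

lemma unit_step_cong: "(\<And>l. l < k \<Longrightarrow> v l = w l) \<Longrightarrow> unit_step k v \<longleftrightarrow> unit_step k w"
  by (auto simp: unit_step_def)

lemma unit_step_bound: "unit_step k v \<Longrightarrow> l < k \<Longrightarrow> \<bar>v l\<bar> \<le> 1"
  by (force simp: unit_step_def)

lemma cong_int_small_eq:
  fixes a b :: int
  assumes "[a = b] (mod m)" "\<bar>a - b\<bar> < m"
  shows "a = b"
  using assms dvd_imp_le_int[of "a - b" m] by (auto simp: cong_iff_dvd_diff)

lemma cartesian_power_pverts:
  "pverts (cartesian_power G k) = {xs. length xs = k \<and> set xs \<subseteq> pverts G}"
proof (induction k)
  case (Suc k)
  have "pverts (cartesian_power G (Suc k)) = (\<lambda>(u, vs). u # vs) `
      (pverts G \<times> {xs. length xs = k \<and> set xs \<subseteq> pverts G})"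
    by (simp add: relabel_graph_def cartesian_product_def Suc.IH)
  also have "\<dots> = {xs. length xs = Suc k \<and> set xs \<subseteq> pverts G}"
    by (auto simp: length_Suc_conv image_iff)
  finally show ?case .
qed auto

lemma cartesian_power_parcs:
  assumes "pair_graph G"
  shows "(xs, ys) \<in> parcs (cartesian_power G k) \<longleftrightarrow>
     xs \<in> pverts (cartesian_power G k) \<and> ys \<in> pverts (cartesian_power G k) \<and>
     (\<exists>l<k. (xs ! l, ys ! l) \<in> parcs G \<and> (\<forall>m<k. m \<noteq> l \<longrightarrow> xs ! m = ys ! m))"
proof (induction k arbitrary: xs ys)
  case 0
  show ?case by simp
next
  case (Suc k)
  let ?V = "pverts (cartesian_power G k)"
  have arcs: "u \<in> pverts G" "v \<in> pverts G" if "(u, v) \<in> parcs G" for u v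
    using that assms by (auto simp: pair_graph_iff)
  have len: "length us = k" if "us \<in> ?V" for us
    using that by (simp add: cartesian_power_pverts)
  have "(xs, ys) \<in> parcs (cartesian_power G (Suc k)) \<longleftrightarrow>
      (\<exists>u v us vs. xs = u # us \<and> ys = v # vs \<and>
         (u = v \<and> u \<in> pverts G \<and> (us, vs) \<in> parcs (cartesian_power G k) \<or>
          (u, v) \<in> parcs G \<and> us = vs \<and> us \<in> ?V))"
    by (force simp: relabel_graph_def cartesian_product_def image_iff)
  also have "\<dots> \<longleftrightarrow> (\<exists>u v us vs. xs = u # us \<and> ys = v # vs \<and>
      u \<in> pverts G \<and> v \<in> pverts G \<and> us \<in> ?V \<and> vs \<in> ?V \<and>
         (u = v \<and> (\<exists>l<k. (us ! l, vs ! l) \<in> parcs G \<and> (\<forall>m<k. m \<noteq> l \<longrightarrow> us ! m = vs ! m)) \<or>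
          (u, v) \<in> parcs G \<and> (\<forall>m<k. us ! m = vs ! m)))"
    unfolding Suc.IH using arcs len by (auto intro!: nth_equalityI)
  also have "\<dots> \<longleftrightarrow> (\<exists>u v us vs. xs = u # us \<and> ys = v # vs \<and>
      u \<in> pverts G \<and> v \<in> pverts G \<and> us \<in> ?V \<and> vs \<in> ?V \<and>
         (\<exists>l<Suc k. (xs ! l, ys ! l) \<in> parcs G \<and> (\<forall>m<Suc k. m \<noteq> l \<longrightarrow> xs ! m = ys ! m)))"
    by (intro ex_cong1) (auto simp: Ex_less_Suc2 All_less_Suc2)
  also have "\<dots> \<longleftrightarrow> xs \<in> pverts (cartesian_power G (Suc k)) \<and> ys \<in> pverts (cartesian_power G (Suc k)) \<and>
     (\<exists>l<Suc k. (xs ! l, ys ! l) \<in> parcs G \<and> (\<forall>m<Suc k. m \<noteq> l \<longrightarrow> xs ! m = ys ! m))"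
    unfolding cartesian_power_pverts by (auto simp: length_Suc_conv)
  finally show ?case .
qed

text \<open>
The characterization includes \<open>q = 2\<close>, where the steps \<open>1\<close> and \<open>-1\<close> agree modulo \<open>q\<close>.
\<close>

lemma cycle_graph_arc_iff:
  assumes "q \<ge> 2" "a < q" "b < q"
  shows "(a, b) \<in> parcs (cycle_graph q) \<longleftrightarrow>
    (\<exists>s::int. \<bar>s\<bar> = 1 \<and> [int a - int b = s] (mod int q))"
proof -
  have "[int a - int b = 1] (mod int q) \<longleftrightarrow> a = Suc b mod q"
  proof -
    have "[int a - int b = 1] (mod int q) \<longleftrightarrow> [int a = int (Suc b)] (mod int q)"
      by (simp add: cong_iff_dvd_diff algebra_simps)
    also have "\<dots> \<longleftrightarrow> a = Suc b mod q"
      using assms by (simp only: cong_int_iff) (simp add: cong_def)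
    finally show ?thesis .
  qed
  moreover have "[int a - int b = -1] (mod int q) \<longleftrightarrow> b = Suc a mod q"
  proof -
    have "[int a - int b = -1] (mod int q) \<longleftrightarrow> [int (Suc a) = int b] (mod int q)"
      by (simp add: cong_iff_dvd_diff algebra_simps)
    also have "\<dots> \<longleftrightarrow> b = Suc a mod q"
      using assms by (simp only: cong_int_iff) (auto simp: cong_def)
    finally show ?thesis .
  qed
  moreover have "Suc c mod q \<noteq> c" if "c < q" for c
    using assms(1) that by (auto simp: mod_Suc)
  moreover have "(\<exists>s::int. \<bar>s\<bar> = 1 \<and> P s) \<longleftrightarrow> P 1 \<or> P (-1)" for P
    by (metis abs_1 abs_minus_cancel abs_eq_iff)
  ultimately show ?thesis
    using assms by (auto simp: cycle_graph_def)
qed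

abbreviation torus :: "nat \<Rightarrow> nat \<Rightarrow> nat list pair_pre_digraph" where
  "torus q k \<equiv> cartesian_power (cycle_graph q) k"

lemma pair_graph_torus: "pair_graph (torus q k)"
  by (intro pair_graph_cartesian_power pair_graph_cycle_graph)

lemma torus_pverts: "pverts (torus q k) = {xs. length xs = k \<and> set xs \<subseteq> {..<q}}"
  by (simp add: cartesian_power_pverts cycle_graph_def)

lemma card_torus_pverts: "card (pverts (torus q k)) = q ^ k"
  using card_lists_length_eq[of "{..<q}" k] by (simp add: torus_pverts conj_commute)

lemma torus_arc_iff:
  assumes "q \<ge> 2" "xs \<in> pverts (torus q k)" "ys \<in> pverts (torus q k)"
  shows "(xs, ys) \<in> parcs (torus q k) \<longleftrightarrow>
    (\<exists>s. unit_step k s \<and> (\<forall>l<k. [int (xs ! l) - int (ys ! l) = s l] (mod int q)))"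
proof -
  have lt: "xs ! l < q" "ys ! l < q" if "l < k" for l
    using assms(2,3) that by (auto simp: torus_pverts subset_iff)
  have eq: "xs ! l = ys ! l \<longleftrightarrow> [int (xs ! l) - int (ys ! l) = 0] (mod int q)" if "l < k" for l
    using lt[OF that] by (simp add: cong_diff_iff_cong_0 cong_int_iff) (simp add: cong_def)
  have "(xs, ys) \<in> parcs (torus q k) \<longleftrightarrow>
      (\<exists>l<k. (xs ! l, ys ! l) \<in> parcs (cycle_graph q) \<and> (\<forall>m<k. m \<noteq> l \<longrightarrow> xs ! m = ys ! m))"
    using assms(2,3) by (simp add: cartesian_power_parcs[OF pair_graph_cycle_graph])
  also have "\<dots> \<longleftrightarrow> (\<exists>l<k. (\<exists>s::int. \<bar>s\<bar> = 1 \<and> [int (xs ! l) - int (ys ! l) = s] (mod int q)) \<and>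
      (\<forall>m<k. m \<noteq> l \<longrightarrow> [int (xs ! m) - int (ys ! m) = 0] (mod int q)))"
    using cycle_graph_arc_iff[OF assms(1)] lt eq by (metis (no_types, lifting))
  also have "\<dots> \<longleftrightarrow> (\<exists>s. unit_step k s \<and> (\<forall>l<k. [int (xs ! l) - int (ys ! l) = s l] (mod int q)))"
    (is "?L \<longleftrightarrow> ?R")
  proof
    assume ?L
    then obtain l s where ls: "l < k" "\<bar>s :: int\<bar> = 1" "[int (xs ! l) - int (ys ! l) = s] (mod int q)"
        "\<forall>m<k. m \<noteq> l \<longrightarrow> [int (xs ! m) - int (ys ! m) = 0] (mod int q)" by blast
    then show ?R
      by (intro exI[of _ "\<lambda>m. if m = l then s else 0"]) (auto simp: unit_step_def)
  next
    assume ?R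
    then obtain s l where sl: "l < k" "\<bar>s l\<bar> = 1" "\<forall>m<k. m \<noteq> l \<longrightarrow> s m = (0::int)"
        "\<forall>l<k. [int (xs ! l) - int (ys ! l) = s l] (mod int q)" by (auto simp: unit_step_def)
    then show ?L
      by (metis (no_types, lifting))
  qed
  finally show ?thesis .
qed

section \<open>Lifting to the integer lattice\<close>

lemma class_size_le:
  assumes "finite U" "B \<subseteq> U \<times> U" "i \<in> U"
  shows "card {x \<in> U. (i, x) \<in> linked B} + card (class_rep B ` U) \<le> Suc (card U)"
proof -
  let ?C = "{x \<in> U. (i, x) \<in> linked B}"
  let ?R = "class_rep B ` U - {class_rep B i}"
  have "?C \<inter> ?R = {}"
    by (auto simp flip: class_rep_eq_iff)
  moreover have "?C \<union> ?R \<subseteq> U"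
    using class_rep_in[OF assms(2)] by auto
  ultimately have "card ?C + card ?R \<le> card U"
    using assms(1) by (subst card_Un_disjoint[symmetric]) (auto intro: card_mono)
  moreover have "card (class_rep B ` U) = Suc (card ?R)"
    using assms(1,3) by (intro card.remove) auto
  ultimately show ?thesis by simp
qed

text \<open>
A multiple of \<open>q\<close> that is smaller than \<open>q\<close> in absolute value vanishes.  Therefore a map whose
differences along the arcs of \<open>B\<close> are unit steps modulo \<open>q\<close> can be changed by multiples of \<open>q\<close>
so that they become unit steps in the integers, as long as the rank of \<open>B\<close> is at most \<open>q - 2\<close>.

The arcs are inserted one by one.  An arc between two classes is repaired by shifting one class.
An arc within a class is correct already: by the size bound carried along in the induction, two
values in a class differ by at most the rank in each coordinate, so the error of the step is at most
\<open>q - 1\<close> in absolute value and a multiple of \<open>q\<close>.  This is where a cycle winding around the torus is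
excluded, and where the bound on the rank is used to its full extent.
\<close>

lemma lift_exists:
  fixes f :: "'a \<Rightarrow> nat \<Rightarrow> int"
  assumes "finite U" "finite B" "B \<subseteq> U \<times> U"
    and "card U + 2 \<le> q + card (class_rep B ` U)"
    and "\<And>i j. (i, j) \<in> B \<Longrightarrow>
      \<exists>s. unit_step k s \<and> (\<forall>l<k. [f i l - f j l = s l] (mod int q))"
  shows "\<exists>g. (\<forall>i l. [g i l = f i l] (mod int q)) \<and>
    (\<forall>(i, j)\<in>B. unit_step k (\<lambda>l. g i l - g j l)) \<and>
    (\<forall>i\<in>U. \<forall>j. (i, j) \<in> linked B \<longrightarrow>
       (\<forall>l<k. \<bar>g i l - g j l\<bar> < int (card {x \<in> U. (i, x) \<in> linked B})))"
  using assms(2-)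
proof (induction B rule: finite_induct)
  case empty
  then show ?case
    using assms(1) by (intro exI[of _ f]) (auto simp: card_gt_0_iff)
next
  case (insert e B)
  obtain i j where e: "e = (i, j)" by (cases e)
  let ?B' = "insert (i, j) B"
  let ?C = "\<lambda>B x. {y \<in> U. (x, y) \<in> linked B}"
  have ij: "i \<in> U" "j \<in> U" and BU: "B \<subseteq> U \<times> U"
    using insert.prems(1) by (auto simp: e)
  have "card (class_rep ?B' ` U) \<le> card (class_rep B ` U)"
    using assms(1) by (intro class_count_antimono) auto
  then have rank: "card U + 2 \<le> q + card (class_rep B ` U)"
    using insert.prems(2) by (simp add: e)
  obtain g where g: "\<And>x l. [g x l = f x l] (mod int q)"
      "\<And>x y. (x, y) \<in> B \<Longrightarrow> unit_step k (\<lambda>l. g x l - g y l)"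
      "\<And>x y l. x \<in> U \<Longrightarrow> (x, y) \<in> linked B \<Longrightarrow> l < k \<Longrightarrow> \<bar>g x l - g y l\<bar> < int (card (?C B x))"
    using insert.IH[OF BU rank] insert.prems(3) by fast
  obtain s where s: "unit_step k s" "\<And>l. l < k \<Longrightarrow> [f i l - f j l = s l] (mod int q)"
    using insert.prems(3)[of i j] by (auto simp: e)
  have gs: "[g i l - g j l = s l] (mod int q)" if "l < k" for l
    using cong_trans[OF cong_diff[OF g(1) g(1)] s(2)[OF that]] .
  show ?case
  proof (cases "(i, j) \<in> linked B")
    case True
    have same: "linked ?B' = linked B"
    proof -
      have "(x, y) \<in> linked ?B' \<longleftrightarrow> (x, y) \<in> linked B" for x y
        unfolding linked_insert using True by (meson linked_sym linked_trans)
      then show ?thesis by auto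
    qed
    have "g i l - g j l = s l" if "l < k" for l
    proof (rule cong_int_small_eq[OF gs[OF that]])
      have "int (card (?C B i)) + 1 \<le> int q"
        using class_size_le[OF assms(1) BU ij(1)] rank by linarith
      moreover have "\<bar>g i l - g j l\<bar> < int (card (?C B i))"
        using g(3)[OF ij(1) True that] .
      moreover have "\<bar>s l\<bar> \<le> 1"
        using unit_step_bound[OF s(1) that] .
      ultimately show "\<bar>g i l - g j l - s l\<bar> < int q" by linarith
    qed
    then have "unit_step k (\<lambda>l. g i l - g j l)"
      using s(1) unit_step_cong[of k "\<lambda>l. g i l - g j l" s] by simp
    then show ?thesis
      using g by (intro exI[of _ g]) (auto simp: e same)
  next
    case False
    \<comment> \<open>the multiple of \<open>q\<close> by which the class of \<open>j\<close> has to be shifted down\<close>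
    define z where "z l = (if l < k then s l - (g i l - g j l) else 0)" for l
    define g' where "g' x l = (if (x, j) \<in> linked B then g x l - z l else g x l)" for x l
    have z: "[z l = 0] (mod int q)" for l
      using cong_sym[OF gs[of l]] by (simp add: z_def cong_diff_iff_cong_0)
    have g'B: "g' x l - g' y l = g x l - g y l" if "(x, y) \<in> linked B" for x y l
    proof -
      have "(x, j) \<in> linked B \<longleftrightarrow> (y, j) \<in> linked B"
        using that by (meson linked_sym linked_trans)
      then show ?thesis by (simp add: g'_def)
    qed
    have g'ij: "g' i l - g' j l = s l" if "l < k" for l
      using False that by (simp add: g'_def z_def)
    have C_ij: "?C ?B' x = ?C B i \<union> ?C B j" if "(x, i) \<in> linked B \<or> (x, j) \<in> linked B" for x
      using that by (auto simp: linked_insert) (meson linked_sym linked_trans)+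
    have "?C B i \<inter> ?C B j = {}"
      using False by (auto dest: linked_sym linked_trans)
    then have card_C: "card (?C B i \<union> ?C B j) = card (?C B i) + card (?C B j)"
      using assms(1) by (intro card_Un_disjoint) auto
    have across: "\<bar>g' x l - g' y l\<bar> < int (card (?C ?B' x))"
      if xy: "(x, i) \<in> linked B" "(j, y) \<in> linked B" and l: "l < k" for x y l
    proof -
      have "\<bar>g' x l - g' i l\<bar> < int (card (?C B i))"
        using g(3)[OF ij(1) linked_sym[OF xy(1)] l] g'B[OF xy(1)] by (simp add: abs_minus_commute)
      moreover have "\<bar>g' j l - g' y l\<bar> < int (card (?C B j))"
        using g(3)[OF ij(2) xy(2) l] g'B[OF xy(2)] by simp
      moreover have "\<bar>g' i l - g' j l\<bar> \<le> 1"
        using unit_step_bound[OF s(1) l] g'ij[OF l] by simp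
      ultimately show ?thesis
        using C_ij[of x] xy(1) card_C by simp
    qed
    have bound: "\<bar>g' x l - g' y l\<bar> < int (card (?C ?B' x))"
      if xy: "x \<in> U" "(x, y) \<in> linked ?B'" and l: "l < k" for x y l
    proof -
      consider "(x, y) \<in> linked B" | "(x, i) \<in> linked B" "(j, y) \<in> linked B"
        | "(x, j) \<in> linked B" "(i, y) \<in> linked B"
        using xy(2) by (auto simp: linked_insert)
      then show ?thesis
      proof cases
        case 1
        have "card (?C B x) \<le> card (?C ?B' x)"
          using assms(1) by (intro card_mono) (auto simp: linked_insert)
        then show ?thesis
          using g(3)[OF xy(1) 1 l] g'B[OF 1, of l] by simp
      next
        case 2
        then show ?thesis using across l by simp
      next
        case 3
        have "\<bar>g' y l - g' x l\<bar> < int (card (?C ?B' y))"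
          using 3 l by (intro across) (auto intro: linked_sym)
        moreover have "?C ?B' y = ?C ?B' x"
          using C_ij[of x] C_ij[of y] 3(1) linked_sym[OF 3(2)] by simp
        ultimately show ?thesis by (simp add: abs_minus_commute)
      qed
    qed
    have "[g' x l = f x l] (mod int q)" for x l
      using cong_diff[OF g(1) z, of x l l] g(1) by (simp add: g'_def)
    moreover have "unit_step k (\<lambda>l. g' x l - g' y l)" if "(x, y) \<in> ?B'" for x y
    proof (cases "(x, y) \<in> B")
      case True
      then show ?thesis
        using g(2)[OF True] by (simp add: g'B[OF linked_base[OF True]])
    next
      case False
      then have "x = i" "y = j" using that by auto
      then show ?thesis
        using s(1) g'ij unit_step_cong[of k "\<lambda>l. g' i l - g' j l" s] by simp
    qed
    ultimately show ?thesis
      using bound unfolding e by (intro exI[of _ g']) auto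
  qed
qed

section \<open>Counting homomorphisms into the torus\<close>

text \<open>
The maps from \<open>U\<close> to the integer lattice that make a unit step along each arc of \<open>B\<close> and send the
representative of each class to the origin.  Their number does not involve
the side length of a torus.
\<close>

definition closed_lifts :: "nat \<Rightarrow> 'a set \<Rightarrow> 'a rel \<Rightarrow> ('a \<Rightarrow> nat \<Rightarrow> int) set" where
  "closed_lifts k U B = {g \<in> U \<rightarrow>\<^sub>E ({..<k} \<rightarrow>\<^sub>E UNIV).
     (\<forall>x\<in>U. \<forall>l<k. g (class_rep B x) l = 0) \<and>
     (\<forall>(x, y)\<in>B. unit_step k (\<lambda>l. g x l - g y l))}"

text \<open>
The projection from the integer lattice to the torus.
\<close>

definition wrap :: "nat \<Rightarrow> nat \<Rightarrow> (nat \<Rightarrow> int) \<Rightarrow> nat list" where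
  "wrap q k v = map (\<lambda>l. nat (v l mod int q)) [0..<k]"

lemma nth_wrap: "l < k \<Longrightarrow> q > 0 \<Longrightarrow> int (wrap q k v ! l) = v l mod int q"
  by (simp add: wrap_def)

lemma wrap_in_torus: "q > 0 \<Longrightarrow> wrap q k v \<in> pverts (torus q k)"
  by (auto simp: torus_pverts wrap_def nat_less_iff)

lemma wrap_eqI:
  assumes "q > 0" "xs \<in> pverts (torus q k)" "\<And>l. l < k \<Longrightarrow> [v l = int (xs ! l)] (mod int q)"
  shows "wrap q k v = xs"
proof (rule nth_equalityI)
  fix l assume "l < length (wrap q k v)"
  then have l: "l < k" by (simp add: wrap_def)
  then have "xs ! l < q" using assms(2) by (auto simp: torus_pverts subset_iff)
  then have "int (wrap q k v ! l) = int (xs ! l)"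
    using assms(3)[OF l] l assms(1) by (simp add: nth_wrap cong_def)
  then show "wrap q k v ! l = xs ! l" by simp
qed (use assms(2) in \<open>simp add: wrap_def torus_pverts\<close>)

lemma wrap_arc:
  assumes "q \<ge> 2" "unit_step k s" "\<And>l. l < k \<Longrightarrow> v l - w l = s l"
  shows "(wrap q k v, wrap q k w) \<in> parcs (torus q k)"
proof -
  have "[int (wrap q k v ! l) - int (wrap q k w ! l) = s l] (mod int q)" if "l < k" for l
    using assms(1,3) that by (auto simp: nth_wrap cong_def mod_diff_eq)
  then show ?thesis
    using assms by (subst torus_arc_iff) (auto intro: wrap_in_torus)
qed

text \<open>
A homomorphism from a pattern of small rank is determined by the images of the class
representatives, which are arbitrary, and by the unique lift of each class that starts at the
origin.  Hence the count is a constant times a power of the number of vertices of the torus.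
\<close>

lemma card_homs_torus:
  fixes U :: "'a set"
  assumes "finite U" "B \<subseteq> U \<times> U" "card U + 2 \<le> q + card (class_rep B ` U)"
  shows "card (homs (torus q k) U B) = card (closed_lifts k U B) * (q ^ k) ^ card (class_rep B ` U)"
proof -
  let ?R = "class_rep B ` U"
  let ?V = "pverts (torus q k)"
  let ?D = "closed_lifts k U B \<times> (?R \<rightarrow>\<^sub>E ?V)"
  let ?h = "\<lambda>(g, b). \<lambda>x\<in>U. wrap q k (\<lambda>l. g x l + int (b (class_rep B x) ! l))"
  have finB: "finite B"
    using assms(1,2) by (meson finite_SigmaI finite_subset)
  have q2: "q \<ge> 2"
    using assms(3) card_image_le[OF assms(1), of "class_rep B"] by linarith
  have repU: "class_rep B x \<in> U" if "x \<in> U" for x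
    using class_rep_in[OF assms(2) that] .
  have "bij_betw ?h ?D (homs (torus q k) U B)"
    unfolding bij_betw_def
  proof
    show "inj_on ?h ?D"
    proof (rule inj_onI, clarify)
      fix g b g' b'
      assume g: "g \<in> closed_lifts k U B" "g' \<in> closed_lifts k U B"
        and b: "b \<in> ?R \<rightarrow>\<^sub>E ?V" "b' \<in> ?R \<rightarrow>\<^sub>E ?V"
        and eq: "(\<lambda>x\<in>U. wrap q k (\<lambda>l. g x l + int (b (class_rep B x) ! l)))
               = (\<lambda>x\<in>U. wrap q k (\<lambda>l. g' x l + int (b' (class_rep B x) ! l)))"
      have eq': "wrap q k (\<lambda>l. g x l + int (b (class_rep B x) ! l))
               = wrap q k (\<lambda>l. g' x l + int (b' (class_rep B x) ! l))" if "x \<in> U" for x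
        using fun_cong[OF eq, of x] that by simp
      have bV: "b r \<in> ?V" "b' r \<in> ?V" if "r \<in> ?R" for r
        using b that by auto
      have "b = b'"
      proof (rule PiE_ext[OF b])
        fix r assume r: "r \<in> ?R"
        then obtain x where x: "x \<in> U" "r = class_rep B x" by auto
        have "wrap q k (\<lambda>l. g r l + int (b r ! l)) = b r"
          using q2 r x g(1) bV by (intro wrap_eqI) (auto simp: closed_lifts_def)
        moreover have "wrap q k (\<lambda>l. g' r l + int (b' r ! l)) = b' r"
          using q2 r x g(2) bV by (intro wrap_eqI) (auto simp: closed_lifts_def)
        ultimately show "b r = b' r"
          using eq'[of r] repU x by simp
      qed
      have cong: "[g x l = g' x l] (mod int q)" if "x \<in> U" "l < k" for x l
      proof -
        have "(g x l + int (b (class_rep B x) ! l)) mod int q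
            = (g' x l + int (b (class_rep B x) ! l)) mod int q"
          using arg_cong[OF eq'[OF that(1)], of "\<lambda>xs. int (xs ! l)"] that q2 \<open>b = b'\<close>
          by (simp add: nth_wrap)
        then show ?thesis
          by (simp flip: cong_def add: cong_add_rcancel)
      qed
      have edge: "g x l - g' x l = g y l - g' y l" if xy: "(x, y) \<in> B" and l: "l < k" for x y l
      proof -
        have U: "x \<in> U" "y \<in> U" using assms(2) xy by auto
        have st: "unit_step k (\<lambda>l. g x l - g y l)" "unit_step k (\<lambda>l. g' x l - g' y l)"
          using g xy by (auto simp: closed_lifts_def)
        \<comment> \<open>The steps \<open>1\<close> and \<open>-1\<close> agree modulo \<open>2\<close>; but an arc that is no loop makes the rank
          positive, and then \<open>q\<close> is at least \<open>3\<close>.\<close>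
        have "x \<noteq> y" using st(1) by (auto simp: unit_step_def)
        then have "\<not> inj_on (class_rep B) U"
          using U class_rep_base[OF xy] by (auto dest: inj_onD)
        then have "card ?R < card U"
          using assms(1) by (meson card_image_le eq_card_imp_inj_on le_neq_implies_less)
        then have "int q > 2" using assms(3) by linarith
        moreover have "[g x l - g y l = g' x l - g' y l] (mod int q)"
          using U l by (intro cong_diff cong)
        ultimately have "g x l - g y l = g' x l - g' y l"
          using unit_step_bound[OF st(1) l] unit_step_bound[OF st(2) l]
          by (intro cong_int_small_eq[of _ _ "int q"]) auto
        then show ?thesis by simp
      qed
      have "g x l = g' x l" if x: "x \<in> U" and l: "l < k" for x l
      proof -
        have "g x l - g' x l = g (class_rep B x) l - g' (class_rep B x) l"
          by (rule linked_const[OF class_rep_linked]) (rule edge[OF _ l])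
        also have "\<dots> = 0"
          using g x l by (auto simp: closed_lifts_def)
        finally show ?thesis by simp
      qed
      moreover have "g x \<in> {..<k} \<rightarrow>\<^sub>E UNIV" "g' x \<in> {..<k} \<rightarrow>\<^sub>E UNIV" if "x \<in> U" for x
        using g that by (auto simp: closed_lifts_def)
      ultimately have "g x = g' x" if "x \<in> U" for x
        using that by (intro PiE_ext[of "g x" "{..<k}" "\<lambda>_. UNIV" "g' x"]) auto
      then have "g = g'"
        using g by (intro PiE_ext[of g U "\<lambda>_. {..<k} \<rightarrow>\<^sub>E UNIV" g']) (auto simp: closed_lifts_def)
      with \<open>b = b'\<close> show "g = g' \<and> b = b'" by simp
    qed
  next
    show "?h ` ?D = homs (torus q k) U B"
    proof (intro equalityI subsetI)
      fix f assume "f \<in> ?h ` ?D"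
      then obtain g b where g: "g \<in> closed_lifts k U B" and f: "f = ?h (g, b)" by auto
      have "(f x, f y) \<in> parcs (torus q k)" if xy: "(x, y) \<in> B" for x y
      proof -
        have "x \<in> U" "y \<in> U" using assms(2) xy by auto
        moreover have "unit_step k (\<lambda>l. g x l - g y l)"
          using g xy by (auto simp: closed_lifts_def)
        ultimately show ?thesis
          unfolding f using class_rep_base[OF xy] by (auto intro!: wrap_arc[OF q2])
      qed
      moreover have "f \<in> U \<rightarrow>\<^sub>E ?V"
        unfolding f using q2 by (auto intro!: wrap_in_torus)
      ultimately show "f \<in> homs (torus q k) U B"
        by (auto simp: homs_def)
    next
      fix f assume f: "f \<in> homs (torus q k) U B"
      then have fV: "f x \<in> ?V" if "x \<in> U" for x
        using that by (auto simp: homs_def)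
      have step: "\<exists>s. unit_step k s \<and> (\<forall>l<k. [int (f x ! l) - int (f y ! l) = s l] (mod int q))"
        if xy: "(x, y) \<in> B" for x y
      proof -
        have "f x \<in> ?V" "f y \<in> ?V" "(f x, f y) \<in> parcs (torus q k)"
          using f xy assms(2) by (auto simp: homs_def)
        then show ?thesis using torus_arc_iff[OF q2] by blast
      qed
      obtain G where G: "\<And>x l. [G x l = int (f x ! l)] (mod int q)"
          "\<And>x y. (x, y) \<in> B \<Longrightarrow> unit_step k (\<lambda>l. G x l - G y l)"
        using lift_exists[OF assms(1) finB assms(2,3), of k "\<lambda>x l. int (f x ! l)"] step by blast
      define g where "g = (\<lambda>x\<in>U. \<lambda>l\<in>{..<k}. G x l - G (class_rep B x) l)"
      define b where "b = restrict f ?R"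
      have "g \<in> closed_lifts k U B"
      proof -
        have "unit_step k (\<lambda>l. g x l - g y l)" if xy: "(x, y) \<in> B" for x y
        proof -
          have "x \<in> U" "y \<in> U" using assms(2) xy by auto
          then have "g x l - g y l = G x l - G y l" if "l < k" for l
            using class_rep_base[OF xy] that by (simp add: g_def)
          then show ?thesis
            using G(2)[OF xy] unit_step_cong[of k "\<lambda>l. g x l - g y l" "\<lambda>l. G x l - G y l"] by simp
        qed
        moreover have "g \<in> U \<rightarrow>\<^sub>E ({..<k} \<rightarrow>\<^sub>E UNIV)"
          by (auto simp: g_def)
        moreover have "\<forall>x\<in>U. \<forall>l<k. g (class_rep B x) l = 0"
          using repU by (simp add: g_def)
        ultimately show ?thesis by (auto simp: closed_lifts_def)
      qed
      moreover have "b \<in> ?R \<rightarrow>\<^sub>E ?V"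
        using fV repU by (auto simp: b_def)
      moreover have "?h (g, b) = f"
      proof (rule extensionalityI[of _ U])
        fix x assume x: "x \<in> U"
        have "wrap q k (\<lambda>l. g x l + int (b (class_rep B x) ! l)) = f x"
        proof (rule wrap_eqI)
          fix l assume l: "l < k"
          have "[G x l - G (class_rep B x) l + int (f (class_rep B x) ! l)
              = int (f x ! l) - int (f (class_rep B x) ! l) + int (f (class_rep B x) ! l)] (mod int q)"
            by (intro cong_add cong_diff G(1) cong_refl)
          then show "[g x l + int (b (class_rep B x) ! l) = int (f x ! l)] (mod int q)"
            using x l by (simp add: g_def b_def)
        qed (use q2 fV x in auto)
        then show "?h (g, b) x = f x"
          using x by simp
      qed (use f in \<open>auto simp: homs_def PiE_def\<close>)
      ultimately show "f \<in> ?h ` ?D"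
        by (intro image_eqI[of _ _ "(g, b)"]) auto
    qed
  qed
  from bij_betw_same_card[OF this] show ?thesis
    using assms(1) by (simp add: card_cartesian_product card_funcsetE card_torus_pverts)
qed

section \<open>Polynomial dependence on the side length\<close>

text \<open>
Passing from a pattern to its quotients by collisions does not raise the rank, so the count of
homomorphisms applies to all quotients with the same bound on \<open>q\<close>.
\<close>

lemma injective_homs_torus_poly:
  assumes "B \<in> patterns u r"
  shows "\<exists>p :: rat poly. \<forall>q\<ge>r + 2.
    of_nat (card {f \<in> homs (torus q k) {..<u} B. inj_on f {..<u}}) = poly p (of_nat q)"
proof -
  let ?U = "{..<u}"
  let ?E = "{e \<in> ?U \<times> ?U. fst e \<noteq> snd e}"
  let ?U' = "\<lambda>D. class_rep D ` ?U"
  let ?B' = "\<lambda>D. map_prod (class_rep D) (class_rep D) ` B"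
  let ?c = "\<lambda>D. card (class_rep (?B' D) ` ?U' D)"
  let ?p = "\<Sum>D\<in>Pow ?E. monom ((-1) ^ card D * rat_of_nat (card (closed_lifts k (?U' D) (?B' D)))) (k * ?c D)"
  have B: "B \<subseteq> ?U \<times> ?U" "card (class_rep B ` ?U) + r = u"
    using assms by (auto simp: patterns_def)
  have "of_nat (card {f \<in> homs (torus q k) ?U B. inj_on f ?U}) = poly ?p (of_nat q)"
    if q: "q \<ge> r + 2" for q
  proof -
    have "card (homs (torus q k) (?U' D) (?B' D))
        = card (closed_lifts k (?U' D) (?B' D)) * (q ^ k) ^ ?c D" for D
    proof (rule card_homs_torus)
      show "?B' D \<subseteq> ?U' D \<times> ?U' D" using B(1) by auto
      show "card (?U' D) + 2 \<le> q + ?c D"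
        using rank_image_le[OF finite_lessThan B(1), of "class_rep D"] B(2) q by simp
    qed simp
    moreover have "finite (pverts (torus q k))"
      using pair_graph_torus by (simp add: pair_graph_iff)
    ultimately show ?thesis
      by (simp add: card_injective_homs[OF _ finite_lessThan B(1)] poly_sum poly_monom
          power_mult mult.assoc)
  qed
  then show ?thesis by blast
qed

lemma coeff_torus_poly:
  "\<exists>p :: rat poly. \<forall>q\<ge>r + 2. coeff_from_top (chromatic_poly (torus q k)) r = poly p (of_nat q)"
proof -
  define P :: "nat \<Rightarrow> nat rel \<Rightarrow> rat poly" where
    "P u B = (SOME p. \<forall>q\<ge>r + 2.
      of_nat (card {f \<in> homs (torus q k) {..<u} B. inj_on f {..<u}}) = poly p (of_nat q))" for u B
  have P: "of_nat (card {f \<in> homs (torus q k) {..<u} B. inj_on f {..<u}}) = poly (P u B) (of_nat q)"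
    if "B \<in> patterns u r" "q \<ge> r + 2" for u B q
    using someI_ex[OF injective_homs_torus_poly[OF that(1), of k]] that(2)
    unfolding P_def by blast
  let ?p = "\<Sum>u\<le>2 * r. smult (1 / fact u) (\<Sum>B\<in>patterns u r. smult ((-1) ^ card B) (P u B))"
  have "coeff_from_top (chromatic_poly (torus q k)) r = poly ?p (of_nat q)" if q: "q \<ge> r + 2" for q
  proof -
    let ?RS = "rank_sets (torus q k) r"
    have fin: "finite ?RS"
    proof -
      have "finite (pverts (torus q k) \<times> pverts (torus q k))"
          "parcs (torus q k) \<subseteq> pverts (torus q k) \<times> pverts (torus q k)"
        using pair_graph_torus[of q k] by (auto simp: pair_graph_iff)
      then have "finite (Pow (parcs (torus q k)))"
        by (simp add: finite_subset)
      then show ?thesis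
        by (rule rev_finite_subset) (auto simp: rank_sets_def)
    qed
    have "coeff_from_top (chromatic_poly (torus q k)) r = (\<Sum>A\<in>?RS. (-1) ^ card A)"
      by (rule coeff_from_top_chromatic_poly[OF pair_graph_torus])
    also have "\<dots> = (\<Sum>u\<le>2 * r. \<Sum>A\<in>{A \<in> ?RS. card (Field A) = u}. (-1) ^ card A)"
      using card_Field_rank_sets[OF pair_graph_torus]
      by (intro sum.group[symmetric] fin) auto
    also have "\<dots> = (\<Sum>u\<le>2 * r. 1 / fact u * (\<Sum>B\<in>patterns u r. (-1) ^ card B * poly (P u B) (of_nat q)))"
    proof (rule sum.cong)
      fix u
      have "fact u * (\<Sum>A\<in>{A \<in> ?RS. card (Field A) = u}. (-1) ^ card A)
          = (\<Sum>B\<in>patterns u r. (-1) ^ card B * poly (P u B) (of_nat q))"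
        unfolding rank_sets_sum_patterns[OF pair_graph_torus] using P q by (intro sum.cong) simp_all
      then show "(\<Sum>A\<in>{A \<in> ?RS. card (Field A) = u}. (-1) ^ card A)
          = 1 / fact u * (\<Sum>B\<in>patterns u r. (-1) ^ card B * poly (P u B) (of_nat q))"
        by (simp add: field_simps)
    qed simp
    finally show ?thesis
      by (simp add: poly_sum)
  qed
  then show ?thesis by blast
qed

theorem theorem48:
  fixes k :: nat
  assumes "k > 0"
  shows "two_level_poly (monom 1 k)
           (\<lambda>q. if q = 0 then -1 else ereal (real q - 2))
           (\<lambda>q. chromatic_poly (cartesian_power (cycle_graph q) k))"
proof -
  define \<phi> :: "nat \<Rightarrow> rat poly" where
    "\<phi> r = (SOME p. \<forall>q\<ge>r + 2.
      coeff_from_top (chromatic_poly (torus q k)) r = poly p (of_nat q))" for r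
  have \<phi>: "coeff_from_top (chromatic_poly (torus q k)) r = poly (\<phi> r) (of_nat q)"
    if "q \<ge> r + 2" for r q
    using someI_ex[OF coeff_torus_poly[of r k]] that unfolding \<phi>_def by blast
  have "numerical_poly (monom 1 k)"
    by (simp add: numerical_poly_def poly_monom flip: of_int_power)
  moreover have "eventually_nonneg (monom 1 k)"
    by (simp add: eventually_nonneg_def poly_monom)
  moreover have "(if q = 0 then -1 else ereal (real q - 2)) \<in> {-1, \<infinity>} \<union> range (\<lambda>m :: nat. ereal (real m))"
    for q
  proof -
    consider "q = 0" | "q = 1" | "q \<ge> 2" by linarith
    then show ?thesis
    proof cases
      case 3
      then have "ereal (real q - 2) \<in> range (\<lambda>m :: nat. ereal (real m))"
        by (intro range_eqI[of _ _ "q - 2"]) (simp add: of_nat_diff)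
      with 3 show ?thesis by simp
    qed (simp_all add: one_ereal_def)
  qed
  moreover have "chromatic_poly (torus q k) \<noteq> 0 \<and>
      of_nat (degree (chromatic_poly (torus q k))) = poly (monom 1 k) (rat_of_nat q)" for q
    using degree_chromatic_poly[OF pair_graph_torus]
    by (simp add: card_torus_pverts poly_monom)
  moreover have "coeff_from_top (chromatic_poly (torus q k)) r = poly (\<phi> r) (of_nat q)"
    if "ereal (real r) \<le> (if q = 0 then -1 else ereal (real q - 2))" for q r
  proof (rule \<phi>)
    have "\<not> ereal (real r) \<le> -1"
      by (simp add: one_ereal_def)
    with that have "q \<noteq> 0" by metis
    then show "r + 2 \<le> q"
      using that by simp
  qed
  ultimately show ?thesis
    unfolding two_level_poly_def by blast
qed

end
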